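(* Let $X$ be a random variable satisfying Assumption 1 and let $Z=(Z_n)_{n\ge0}$ be a Galton-Watson process satisfying Assumption 2 (both stated in the context), and suppose that $p(0)+p(1)=0$. Let $\tilde M_n=\max_{1\le j\le Z_n}S_n^{(j)}$ be the maximum of $Z_n$ independent random walks with step distribution the law of $X$, and let $\alpha=\left(\frac{\log m}{\lambda_+}\right)^{1/r}$. Then, as $n\to\infty$: (i) for every $x\ge\alpha$, $\ \lim_{n\to\infty}\frac1n\log\mathbb{P}(\tilde M_n\ge xn^{1/r})=-(\lambda_+x^r-\log m)$; (ii) for every $x\in[0,\alpha)$, $\ \log\left|\log\mathbb{P}(\tilde M_n\le xn^{1/r})\right|\sim n\log k^*\left(1-\frac{\lambda_+x^r}{\log m}\right)$; (iii) for every $x<0$, $\ \log\mathbb{P}(\tilde M_n\le xn^{1/r})\sim-n(k^* )^n\lambda_-|x|^r$.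
   Context: For functions $f,g:\mathbb{N}\to\mathbb{R}$, $f\sim g$ means $f(n)/g(n)\to1$ as $n\to\infty$. Assumption 1 (step size). The real random variable $X$ is centred ($\mathbb{E}[X]=0$) and there exist $\lambda_+,\lambda_->0$, $r\in(0,1)$ and functions $a_+$, $a_-$, slowly varying at infinity, such that $\mathbb{P}(X\ge x)=a_+(x)e^{-\lambda_+x^r}$ and $\mathbb{P}(X\le -x)=a_-(x)e^{-\lambda_-x^r}$ for all $x\ge 0$. Assumption 2 (branching). $Z=(Z_n)_{n\ge0}$ is a Galton-Watson process with $Z_0=1$ and reproduction law $p=(p(k))_{k\ge0}$ with mean $m=\sum_{k\ge0}kp(k)$; it is supercritical, i.e. $m>1$, and $\mathbb{E}[Z_1\log Z_1]<\infty$. Notation. $k^*=\inf\{k\ge1: p(k)>0\}$ (so $k^*\ge2$ when $p(0)+p(1)=0$). Independent random walks. Let $(X_k^{(j)})_{j,k\ge1}$ be i.i.d. copies of $X$, independent of $Z$; put $S_0^{(j)}=0$ and $S_n^{(j)}=\sum_{k=1}^nX_k^{(j)}$. *)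

theory Defs
  imports "HOL-Probability.Probability" "HOL-Library.Landau_Symbols"
begin

text \<open>
  Slow variation at infinity (Karamata): positivity and measurability are only required on a
  neighbourhood of infinity.
\<close>

definition slowly_varying :: "(real \<Rightarrow> real) \<Rightarrow> bool" where
  "slowly_varying L \<longleftrightarrow>
     (\<exists>A. L \<in> borel_measurable (restrict_space borel {A..}) \<and> (\<forall>x\<ge>A. L x > 0)) \<and>
     (\<forall>t>0. ((\<lambda>x. L (t * x) / L x) \<longlongrightarrow> 1) at_top)"

definition step_assumption ::
  "'b measure \<Rightarrow> ('b \<Rightarrow> real) \<Rightarrow> real \<Rightarrow> real \<Rightarrow> real \<Rightarrow> (real \<Rightarrow> real) \<Rightarrow> (real \<Rightarrow> real) \<Rightarrow> bool" where
  "step_assumption N X lp lm r ap am \<longleftrightarrow>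
     integrable N X \<and> integral\<^sup>L N X = 0 \<and>
     lp > 0 \<and> lm > 0 \<and> 0 < r \<and> r < 1 \<and>
     slowly_varying ap \<and> slowly_varying am \<and>
     (\<forall>x\<ge>0. \<P>(\<omega> in N. X \<omega> \<ge> x) = ap x * exp (- lp * x powr r)) \<and>
     (\<forall>x\<ge>0. \<P>(\<omega> in N. X \<omega> \<le> - x) = am x * exp (- lm * x powr r))"

definition galton_watson :: "'a measure \<Rightarrow> nat pmf \<Rightarrow> (nat \<Rightarrow> 'a \<Rightarrow> nat) \<Rightarrow> bool" where
  "galton_watson M p Z \<longleftrightarrow>
     (\<exists>\<xi> :: nat \<Rightarrow> nat \<Rightarrow> 'a \<Rightarrow> nat.
        prob_space.indep_vars M (\<lambda>_. count_space UNIV) (\<lambda>(n, i). \<xi> n i) UNIV \<and>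
        (\<forall>n i. distr M (count_space UNIV) (\<xi> n i) = measure_pmf p) \<and>
        (\<forall>\<omega>\<in>space M. Z 0 \<omega> = 1 \<and> (\<forall>n. Z (Suc n) \<omega> = (\<Sum>i<Z n \<omega>. \<xi> n i \<omega>))))"

definition offspring_mean :: "nat pmf \<Rightarrow> real" where
  "offspring_mean p = measure_pmf.expectation p real"

text \<open>
  The two integrability conditions say that the mean and the expectation of
  $Z_1 \log Z_1$ are finite; the convention $0 \log 0 = 0$ holds automatically.
\<close>

definition branching_assumption :: "'a measure \<Rightarrow> nat pmf \<Rightarrow> (nat \<Rightarrow> 'a \<Rightarrow> nat) \<Rightarrow> bool" where
  "branching_assumption M p Z \<longleftrightarrow>
     galton_watson M p Z \<and>
     integrable (measure_pmf p) real \<and> offspring_mean p > 1 \<and>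
     integrable M (\<lambda>\<omega>. real (Z 1 \<omega>) * ln (real (Z 1 \<omega>)))"

definition kstar :: "nat pmf \<Rightarrow> nat" where
  "kstar p = Inf {k. k \<ge> 1 \<and> pmf p k > 0}"

text \<open>
  Walks and steps are numbered from 0: \<open>Y j k\<close> is step number $k + 1$ of walk number $j + 1$.
\<close>

definition iid_copies :: "'a measure \<Rightarrow> (nat \<Rightarrow> nat \<Rightarrow> 'a \<Rightarrow> real) \<Rightarrow> 'b measure \<Rightarrow> ('b \<Rightarrow> real) \<Rightarrow> bool" where
  "iid_copies M Y N X \<longleftrightarrow>
     prob_space.indep_vars M (\<lambda>_. borel) (\<lambda>(j, k). Y j k) UNIV \<and>
     (\<forall>j k. distr M borel (Y j k) = distr N borel X)"

text \<open>
  Independence of the two families as a whole: the library's \<open>indep_var\<close> needs a common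
  target type, so it is spelled out through the generated $\sigma$-algebras.
\<close>

definition indep_families ::
  "'a measure \<Rightarrow> (nat \<Rightarrow> 'a \<Rightarrow> nat) \<Rightarrow> (nat \<Rightarrow> nat \<Rightarrow> 'a \<Rightarrow> real) \<Rightarrow> bool" where
  "indep_families M Z Y \<longleftrightarrow>
     prob_space.indep_set M
       {(\<lambda>\<omega> n. Z n \<omega>) -` A \<inter> space M | A. A \<in> sets (Pi\<^sub>M UNIV (\<lambda>_. count_space UNIV))}
       {(\<lambda>\<omega> (j, k). Y j k \<omega>) -` B \<inter> space M | B. B \<in> sets (Pi\<^sub>M UNIV (\<lambda>_. borel))}"

definition walk :: "(nat \<Rightarrow> nat \<Rightarrow> 'a \<Rightarrow> real) \<Rightarrow> nat \<Rightarrow> nat \<Rightarrow> 'a \<Rightarrow> real" where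
  "walk Y j n \<omega> = (\<Sum>k<n. Y j k \<omega>)"

text \<open>
  Unspecified where \<open>Z n \<omega> = 0\<close>, which is a null event as soon as the offspring law
  gives no mass to 0.
\<close>

definition max_walk ::
  "(nat \<Rightarrow> 'a \<Rightarrow> nat) \<Rightarrow> (nat \<Rightarrow> nat \<Rightarrow> 'a \<Rightarrow> real) \<Rightarrow> nat \<Rightarrow> 'a \<Rightarrow> real" where
  "max_walk Z Y n \<omega> = Max ((\<lambda>j. walk Y j n \<omega>) ` {..<Z n \<omega>})"

text \<open>
  A finite limit of $\frac1n \log P_n$, with $\log 0 = -\infty$, entails that $P_n > 0$ eventually.
  Since \<open>ln 0 = 0\<close> here, this has to be said separately when the limit is 0.
\<close>

definition log_rate :: "(nat \<Rightarrow> real) \<Rightarrow> real \<Rightarrow> bool" where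
  "log_rate P c \<longleftrightarrow>
     (\<forall>\<^sub>F n in sequentially. P n > 0) \<and> (\<lambda>n. 1 / real n * ln (P n)) \<longlonglongrightarrow> c"

end

theory Submission
  imports Defs "HOL-Real_Asymp.Real_Asymp"
begin

text \<open>
  Conditioning on \<open>Z\<close>, the probability that all \<open>Z n\<close> walks lie in a set \<open>B\<close> is
  \<open>(f ^^ n) (P (S n \<in> B))\<close>, where \<open>f\<close> is the offspring generating function; so everything is
  about iterates of \<open>f\<close> at a point whose distance to 1 (in (i) and (ii)) or to 0 (in (iii)) is
  known on the logarithmic scale. Near 1, \<open>f\<close> multiplies the distance to 1 by
  approximately \<open>m\<close>; away from 1, \<open>f\<close> behaves like \<open>u \<mapsto> u ^ kstar p\<close> up to a constant factor.
  In (ii), \<open>n * lp * x powr r / ln m\<close> generations are spent near 1, and the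
  remaining ones each multiply \<open>ln\<close> of the iterate by \<open>kstar p\<close>.

  The rate of \<open>P (S n \<ge> x * n powr (1 / r))\<close> comes from the one big jump principle: from below, one
  step makes the whole jump, the sum of the others being of order \<open>n \<lless> n powr (1 / r)\<close>; from
  above, Chernoff's bound with the parameter \<open>\<mu> * y powr (r - 1)\<close> is applied to the steps truncated
  at the level \<open>y = x * n powr (1 / r)\<close>.
\<close>

subsection \<open>Generating functions\<close>

text \<open>The scale \<open>n powr (1 / r)\<close> is the one on which the tail exponent
  \<open>lp * y powr r\<close> is linear in \<open>n\<close>, hence comparable with
  \<open>n * ln m\<close>; at \<alpha> the two balance. As \<open>r < 1\<close> and the tail decays
  no faster than a stretched exponential, a positive exponential moment of a step is infinite, so
  Chernoff's bound requires truncation. With the parameter \<open>\<mu> * y powr (r - 1)\<close> the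
  exponent at the level \<open>y\<close> itself is \<open>\<mu> * y powr r\<close>, the price of one
  jump when \<mu> is just below \<open>lp\<close>; at a fixed \<open>u\<close> it tends to 0, so the
  truncated exponential moment tends to 1. No speed is required of this convergence: the power
  \<open>n\<close> of a quantity tending to 1 is \<open>exp (o(n))\<close>. Two boundary cases shape
  the statements about iterates. At \<open>x = 0\<close> the rate is 0 and does not prevent
  \<open>P (S n > 0)\<close> from approaching 1; the left tail then supplies an exponential lower
  bound for the complement, and a double logarithm does not see the difference.\<close>

definition pgf :: "nat pmf \<Rightarrow> real \<Rightarrow> real" where
  "pgf p u = measure_pmf.expectation p (\<lambda>k. u ^ k)"

lemma integrable_power_pmf [simp]:
  fixes p :: "nat pmf" and u :: real
  assumes "0 \<le> u" "u \<le> 1"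
  shows "integrable (measure_pmf p) (\<lambda>k. u ^ k)"
  by (rule measure_pmf.integrable_const_bound[where B = 1]) (use assms in \<open>auto simp: power_le_one\<close>)

lemma pgf_nonneg: "0 \<le> u \<Longrightarrow> 0 \<le> pgf p u"
  unfolding pgf_def by (intro integral_nonneg_AE) auto

lemma pgf_mono: "0 \<le> u \<Longrightarrow> u \<le> v \<Longrightarrow> v \<le> 1 \<Longrightarrow> pgf p u \<le> pgf p v"
  unfolding pgf_def by (intro integral_mono integrable_power_pmf power_mono) auto

lemma pgf_le_1: "0 \<le> u \<Longrightarrow> u \<le> 1 \<Longrightarrow> pgf p u \<le> 1"
  using pgf_mono[of u 1 p] by (simp add: pgf_def)

lemma pgf_iterate_range:
  assumes "0 \<le> u" "u \<le> 1"
  shows "0 \<le> (pgf p ^^ n) u \<and> (pgf p ^^ n) u \<le> 1"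
  by (induction n) (use assms in \<open>auto simp: pgf_nonneg pgf_le_1\<close>)

section \<open>Bounds for the iterates near 0 and near 1\<close>

locale offspring =
  fixes p :: "nat pmf"
  assumes integrable_offspring: "integrable (measure_pmf p) real"
    and mean_gt_1: "offspring_mean p > 1"
    and pmf_01: "pmf p 0 + pmf p 1 = 0"
begin

abbreviation "m \<equiv> offspring_mean p"
abbreviation "k \<equiv> kstar p"

lemma pmf_0: "pmf p 0 = 0" and pmf_1: "pmf p 1 = 0"
  using pmf_01 pmf_nonneg[of p 0] pmf_nonneg[of p 1] by linarith+

lemma pmf_kstar: "pmf p k > 0" and kstar_ge_2: "k \<ge> 2"
  and kstar_le: "pmf p j > 0 \<Longrightarrow> k \<le> j"
proof -
  obtain i where i: "i \<in> set_pmf p" using set_pmf_not_empty[of p] by blast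
  then have "pmf p i > 0" by (simp add: pmf_positive)
  moreover then have "i \<noteq> 0" using pmf_0 by (cases i) auto
  ultimately have "i \<in> {k. k \<ge> 1 \<and> pmf p k > 0}" by simp
  then have "k \<in> {k. k \<ge> 1 \<and> pmf p k > 0}"
    unfolding kstar_def by (intro Inf_nat_def1) blast
  then have "1 \<le> k" and pos: "pmf p k > 0" by auto
  moreover have "k \<noteq> 1" using pos pmf_1 by (metis less_irrefl)
  ultimately show "pmf p k > 0" "k \<ge> 2" by linarith+
  assume j: "pmf p j > 0"
  then have "j \<noteq> 0" using pmf_0 by (cases j) auto
  with j show "k \<le> j" unfolding kstar_def by (intro cInf_lower) auto
qed

lemma kstar_le_set_pmf: "j \<in> set_pmf p \<Longrightarrow> k \<le> j"
  by (intro kstar_le pmf_positive)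

lemma pgf_le_power:
  assumes "0 \<le> u" "u \<le> 1"
  shows "pgf p u \<le> u ^ k"
proof -
  have "pgf p u \<le> measure_pmf.expectation p (\<lambda>_. u ^ k)"
    unfolding pgf_def
    by (intro integral_mono_AE integrable_power_pmf)
      (use assms in \<open>auto simp: AE_measure_pmf_iff intro!: power_decreasing kstar_le_set_pmf\<close>)
  then show ?thesis by simp
qed

lemma power_le_pgf:
  assumes "0 \<le> u" "u \<le> 1"
  shows "pmf p k * u ^ k \<le> pgf p u"
proof -
  have "pmf p k * u ^ k = measure_pmf.expectation p (\<lambda>j. indicator {k} j * u ^ k)"
    by (simp add: measure_pmf_single)
  also have "\<dots> \<le> pgf p u"
    unfolding pgf_def
  proof (intro integral_mono integrable_power_pmf assms)
    show "integrable (measure_pmf p) (\<lambda>j. indicator {k} j * u ^ k)"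
      by (rule measure_pmf.integrable_const_bound[where B = 1])
        (use assms in \<open>auto simp: power_le_one split: split_indicator\<close>)
  qed (use assms in \<open>auto split: split_indicator\<close>)
  finally show ?thesis .
qed

lemma pgf_iterate_le_power:
  assumes "0 \<le> u" "u \<le> 1"
  shows "(pgf p ^^ n) u \<le> u ^ (k ^ n)"
proof (induction n)
  case (Suc n)
  have "(pgf p ^^ Suc n) u \<le> ((pgf p ^^ n) u) ^ k"
    using pgf_iterate_range[OF assms] by (simp add: pgf_le_power)
  also have "\<dots> \<le> (u ^ (k ^ n)) ^ k"
    using pgf_iterate_range[OF assms] Suc by (intro power_mono) auto
  finally show ?case by (simp add: power_mult[symmetric] mult.commute)
qed auto

text \<open>Iterating \<open>power_le_pgf\<close> collects the constant with exponent
  \<open>1 + k + ... + k ^ (n - 1)\<close>. As \<open>k \<ge> 2\<close>, this is at most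
  \<open>k ^ n\<close>, so the whole loss can be moved into the argument \<open>u\<close>.\<close>

lemma power_le_pgf_iterate:
  assumes "0 \<le> u" "u \<le> 1"
  shows "(pmf p k * u) ^ (k ^ n) \<le> (pgf p ^^ n) u"
proof -
  define c where "c = pmf p k"
  have c: "0 < c" "c \<le> 1" using pmf_kstar by (auto simp: c_def pmf_le_1)
  \<comment> \<open>strengthened by a factor \<open>1 / c\<close>, which absorbs the constant of the next step\<close>
  have "(c * u) ^ (k ^ n) \<le> c * (pgf p ^^ n) u"
  proof (induction n)
    case (Suc n)
    have "(c * u) ^ (k ^ Suc n) = ((c * u) ^ (k ^ n)) ^ k"
      by (simp add: power_mult[symmetric] mult.commute)
    also have "\<dots> \<le> (c * (pgf p ^^ n) u) ^ k"
      using Suc c assms by (intro power_mono) auto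
    also have "\<dots> = c ^ k * ((pgf p ^^ n) u) ^ k" by (simp add: power_mult_distrib)
    also have "\<dots> \<le> c ^ 2 * ((pgf p ^^ n) u) ^ k"
      using c pgf_iterate_range[OF assms] kstar_ge_2
      by (intro mult_right_mono power_decreasing) auto
    also have "\<dots> = c * (c * ((pgf p ^^ n) u) ^ k)" by (simp add: power2_eq_square)
    also have "\<dots> \<le> c * pgf p ((pgf p ^^ n) u)"
      using c pgf_iterate_range[OF assms] power_le_pgf unfolding c_def
      by (intro mult_left_mono) auto
    finally show ?case by simp
  qed auto
  also have "\<dots> \<le> 1 * (pgf p ^^ n) u"
    using c pgf_iterate_range[OF assms] by (intro mult_right_mono) auto
  finally show ?thesis by (simp add: c_def)
qed

text \<open>Bernoulli's inequality under the expectation: the graph of \<open>pgf p\<close> lies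
  above its tangent at 1, which has slope \<open>m\<close>.\<close>

lemma survival_le:
  assumes "0 \<le> s" "s \<le> 1"
  shows "1 - pgf p (1 - s) \<le> m * s"
proof -
  have "1 - m * s = measure_pmf.expectation p (\<lambda>j. 1 - real j * s)"
    using integrable_offspring by (simp add: offspring_mean_def)
  also have "\<dots> \<le> pgf p (1 - s)"
    unfolding pgf_def
  proof (intro integral_mono integrable_power_pmf)
    fix j show "1 - real j * s \<le> (1 - s) ^ j"
      using Bernoulli_inequality[of "- s" j] assms by simp
  qed (use assms integrable_offspring in auto)
  finally show ?thesis by simp
qed

lemma survival_iterate_le:
  assumes "0 \<le> s" "s \<le> 1"
  shows "1 - (pgf p ^^ n) (1 - s) \<le> m ^ n * s"
proof (induction n)
  case (Suc n)
  have "1 - (pgf p ^^ Suc n) (1 - s) \<le> m * (1 - (pgf p ^^ n) (1 - s))"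
    using survival_le[of "1 - (pgf p ^^ n) (1 - s)"] pgf_iterate_range[of "1 - s" n p] assms by simp
  also have "\<dots> \<le> m * (m ^ n * s)"
    using Suc mean_gt_1 by (intro mult_left_mono) auto
  finally show ?case by (simp add: mult_ac)
qed auto

text \<open>The left derivative of \<open>pgf p\<close> at 1 is \<open>m\<close>, by dominated
  convergence with the offspring number itself as dominating function. Convergence along one
  sequence is enough: the difference quotient increases as \<open>s\<close> decreases, so a bound at
  \<delta> passes to all smaller \<open>s\<close>.\<close>

lemma survival_ge:
  assumes "c < m"
  obtains \<delta> where "0 < \<delta>" "\<delta> < 1" "\<And>s. 0 \<le> s \<Longrightarrow> s \<le> \<delta> \<Longrightarrow> c * s \<le> 1 - pgf p (1 - s)"
proof -
  \<comment> \<open>the difference quotient \<open>(1 - (1 - s) ^ j) / s\<close>, antimonotone in \<open>s\<close>\<close>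
  define h where "h s j = (\<Sum>i<j. (1 - s) ^ i)" for s :: real and j :: nat
  have h_le: "0 \<le> h s j" "h s j \<le> real j" if "0 \<le> s" "s \<le> 1" for s j
  proof -
    show "0 \<le> h s j" using that by (auto simp: h_def intro!: sum_nonneg)
    have "h s j \<le> (\<Sum>i<j. 1)" unfolding h_def
      by (rule sum_mono) (use that in \<open>auto intro!: power_le_one\<close>)
    then show "h s j \<le> real j" by simp
  qed
  have h_int: "integrable (measure_pmf p) (h s)" if "0 \<le> s" "s \<le> 1" for s
    by (rule Bochner_Integration.integrable_bound[OF integrable_offspring])
      (use h_le[OF that] in auto)
  have h_eq: "1 - pgf p (1 - s) = s * measure_pmf.expectation p (h s)" if "0 \<le> s" "s \<le> 1" for s
  proof -
    have "1 - pgf p (1 - s) = measure_pmf.expectation p (\<lambda>j. 1 - (1 - s) ^ j)"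
      using that by (simp add: pgf_def)
    also have "\<dots> = measure_pmf.expectation p (\<lambda>j. s * h s j)"
      by (intro Bochner_Integration.integral_cong refl)
        (simp add: h_def one_diff_power_eq)
    finally show ?thesis by simp
  qed
  \<comment> \<open>The shift by 2 keeps every sampled point strictly between 0 and 1.\<close>
  have "(\<lambda>i. measure_pmf.expectation p (h (1 / (real i + 2)))) \<longlonglongrightarrow> measure_pmf.expectation p real"
  proof (rule integral_dominated_convergence)
    show "integrable (measure_pmf p) real" by (rule integrable_offspring)
    have "(\<lambda>i. h (1 / (real i + 2)) j) \<longlonglongrightarrow> (\<Sum>i<j. (1 - 0) ^ i)" for j
      unfolding h_def
      by (intro tendsto_intros) real_asymp
    then show "AE j in measure_pmf p. (\<lambda>i. h (1 / (real i + 2)) j) \<longlonglongrightarrow> real j"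
      by simp
    fix i
    show "AE j in measure_pmf p. norm (h (1 / (real i + 2)) j) \<le> real j"
      using h_le[of "1 / (real i + 2)"] by (intro AE_I2) (auto simp: field_simps)
  qed auto
  then have "\<forall>\<^sub>F i in sequentially. c < measure_pmf.expectation p (h (1 / (real i + 2)))"
    using assms by (intro order_tendstoD(1)) (auto simp: offspring_mean_def)
  then obtain i where i: "c < measure_pmf.expectation p (h (1 / (real i + 2)))"
    by (auto simp: eventually_sequentially)
  define \<delta> where "\<delta> = 1 / (real i + 2)"
  have \<delta>: "0 < \<delta>" "\<delta> < 1" by (auto simp: \<delta>_def field_simps)
  moreover have "c * s \<le> 1 - pgf p (1 - s)" if s: "0 \<le> s" "s \<le> \<delta>" for s
  proof -
    have "measure_pmf.expectation p (h \<delta>) \<le> measure_pmf.expectation p (h s)"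
      using s \<delta> by (intro integral_mono h_int) (auto simp: h_def intro!: sum_mono power_mono)
    then have "c \<le> measure_pmf.expectation p (h s)" using i by (simp add: \<delta>_def)
    then have "s * c \<le> s * measure_pmf.expectation p (h s)" using s by (intro mult_left_mono)
    then show ?thesis using s \<delta> h_eq[of s] by (simp add: mult.commute[of c])
  qed
  ultimately show ?thesis using that by blast
qed

text \<open>Multiplication by \<open>c\<close> is guaranteed only up to the distance \<delta>.
  Beyond it, monotonicity of \<open>pgf p\<close> and \<open>c \<ge> 1\<close> keep the distance
  from falling below \<delta> again, hence the minimum.\<close>

lemma survival_iterate_ge:
  assumes "1 \<le> c" "c < m"
  obtains \<delta> where "0 < \<delta>" "\<delta> < 1"
    "\<And>s n. 0 \<le> s \<Longrightarrow> s \<le> 1 \<Longrightarrow> min \<delta> (c ^ n * s) \<le> 1 - (pgf p ^^ n) (1 - s)"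
proof -
  obtain \<delta> where \<delta>: "0 < \<delta>" "\<delta> < 1" "\<And>s. 0 \<le> s \<Longrightarrow> s \<le> \<delta> \<Longrightarrow> c * s \<le> 1 - pgf p (1 - s)"
    using survival_ge[OF assms(2)] by blast
  have "min \<delta> (c ^ n * s) \<le> 1 - (pgf p ^^ n) (1 - s)" if s: "0 \<le> s" "s \<le> 1" for s n
  proof (induction n)
    case (Suc n)
    define t where "t = min \<delta> (c ^ n * s)"
    have t: "0 \<le> t" "t \<le> \<delta>" using \<delta> s assms by (auto simp: t_def)
    have "min \<delta> (c ^ Suc n * s) \<le> c * t"
    proof -
      have "\<delta> \<le> c * \<delta>" using \<delta> assms by simp
      then show ?thesis by (auto simp: t_def min_def mult_ac)
    qed
    also have "\<dots> \<le> 1 - pgf p (1 - t)" using \<delta> t by blast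
    also have "\<dots> \<le> 1 - pgf p ((pgf p ^^ n) (1 - s))"
      using Suc pgf_iterate_range[of "1 - s" n p] s t \<delta>
      by (intro diff_left_mono pgf_mono) (auto simp: t_def)
    finally show ?case by simp
  qed (use s in auto)
  with \<delta> show ?thesis using that by blast
qed

end

subsection \<open>Logarithmic asymptotics of the iterates\<close>

lemma ln_le_iff:
  fixes x y :: real
  assumes "0 < x"
  shows "ln x \<le> y \<longleftrightarrow> x \<le> exp y"
  by (metis assms exp_le_cancel_iff exp_ln)

text \<open>The exponential lower bound contains the positivity of \<open>P n\<close>, so later
  arguments can avoid the convention \<open>ln 0 = 0\<close>.\<close>

lemma log_rate_iff:
  "log_rate P c \<longleftrightarrow>
    (\<forall>e>0. \<forall>\<^sub>F n in sequentially. exp (real n * (c - e)) \<le> P n \<and> P n \<le> exp (real n * (c + e)))"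
proof (intro iffI allI impI)
  fix e :: real assume e: "e > 0" and "log_rate P c"
  then have pos: "\<forall>\<^sub>F n in sequentially. P n > 0"
    and lim: "(\<lambda>n. 1 / real n * ln (P n)) \<longlonglongrightarrow> c" by (auto simp: log_rate_def)
  have "\<forall>\<^sub>F n in sequentially. c - e < 1 / real n * ln (P n)"
    "\<forall>\<^sub>F n in sequentially. 1 / real n * ln (P n) < c + e"
    using order_tendstoD[OF lim] e by auto
  with pos eventually_gt_at_top[of 0]
  show "\<forall>\<^sub>F n in sequentially. exp (real n * (c - e)) \<le> P n \<and> P n \<le> exp (real n * (c + e))"
  proof eventually_elim
    case (elim n)
    then have "real n * (c - e) \<le> ln (P n)" "ln (P n) \<le> real n * (c + e)"
      by (auto simp: field_simps)
    then show ?case using elim by (simp add: ln_ge_iff ln_le_iff)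
  qed
next
  assume *: "\<forall>e>0. \<forall>\<^sub>F n in sequentially. exp (real n * (c - e)) \<le> P n \<and> P n \<le> exp (real n * (c + e))"
  have pos: "\<forall>\<^sub>F n in sequentially. P n > 0"
    using *[rule_format, OF zero_less_one]
    by (rule eventually_mono) (meson exp_gt_zero less_le_trans)
  have "(\<lambda>n. 1 / real n * ln (P n)) \<longlonglongrightarrow> c"
  proof (rule tendstoI)
    fix e :: real assume "e > 0"
    then have "e / 2 > 0" by simp
    from *[rule_format, OF this] pos eventually_gt_at_top[of 0]
    show "\<forall>\<^sub>F n in sequentially. dist (1 / real n * ln (P n)) c < e"
    proof eventually_elim
      case (elim n)
      then have "real n * (c - e / 2) \<le> ln (P n)" "ln (P n) \<le> real n * (c + e / 2)"
        by (simp_all add: ln_ge_iff ln_le_iff)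
      then have "c - e / 2 \<le> 1 / real n * ln (P n)" "1 / real n * ln (P n) \<le> c + e / 2"
        using elim by (auto simp: field_simps)
      then show ?case using \<open>e > 0\<close> by (auto simp: dist_real_def abs_if)
    qed
  qed
  with pos show "log_rate P c" by (simp add: log_rate_def)
qed

lemma log_rateI:
  assumes "\<And>e. e > 0 \<Longrightarrow> \<forall>\<^sub>F n in sequentially. exp (real n * (c - e)) \<le> P n"
    and "\<And>e. e > 0 \<Longrightarrow> \<forall>\<^sub>F n in sequentially. P n \<le> exp (real n * (c + e))"
  shows "log_rate P c"
  unfolding log_rate_iff using assms by (auto intro: eventually_conj)

lemma log_rateD:
  assumes "log_rate P c" "e > 0"
  shows "\<forall>\<^sub>F n in sequentially. exp (real n * (c - e)) \<le> P n"
    and "\<forall>\<^sub>F n in sequentially. P n \<le> exp (real n * (c + e))"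
  using assms unfolding log_rate_iff by (auto elim: eventually_mono)

text \<open>Only errors below \<open>L\<close> are demanded: in the double logarithmic estimate, too
  large an error would ask for more than \<open>n\<close> generations near 1.\<close>

lemma asymp_equiv_linearI:
  assumes L: "L > 0"
    and lower: "\<And>e. 0 < e \<Longrightarrow> e < L \<Longrightarrow> \<forall>\<^sub>F n in sequentially. real n * (L - e) \<le> A n"
    and upper: "\<And>e. 0 < e \<Longrightarrow> e < L \<Longrightarrow> \<forall>\<^sub>F n in sequentially. A n \<le> real n * (L + e)"
  shows "A \<sim>[sequentially] (\<lambda>n. real n * L)"
proof (rule asymp_equivI')
  have "(\<lambda>n. A n / (real n)) \<longlonglongrightarrow> L"
  proof (rule tendstoI)
    fix e :: real assume "e > 0"
    define d where "d = min e L / 2"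
    have d: "0 < d" "d < L" "d < e" using \<open>e > 0\<close> L by (auto simp: d_def)
    from lower[OF d(1,2)] upper[OF d(1,2)] eventually_gt_at_top[of 0]
    show "\<forall>\<^sub>F n in sequentially. dist (A n / real n) L < e"
    proof eventually_elim
      case (elim n)
      then have "L - d \<le> A n / real n" "A n / real n \<le> L + d" by (auto simp: field_simps)
      then show ?case using d by (auto simp: dist_real_def abs_if)
    qed
  qed
  then have "(\<lambda>n. A n / real n / L) \<longlonglongrightarrow> L / L"
    by (intro tendsto_divide) (use L in auto)
  then show "(\<lambda>n. A n / (real n * L)) \<longlonglongrightarrow> 1" using L by simp
qed

context offspring
begin

lemma kstar_gt_1: "1 < real k"
  using kstar_ge_2 by simp

lemma ln_kstar_pos: "0 < ln (real k)"
  using kstar_gt_1 by simp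

lemma ln_mean_pos: "0 < ln m"
  using mean_gt_1 by simp

text \<open>For \<open>l \<ge> ln m\<close> the product \<open>m ^ n * q n\<close> does not grow
  exponentially, so the iterate stays in the linear regime near 1 on the logarithmic scale. In the
  critical case \<open>l = ln m\<close> the limit is 0, and the cap in
  \<open>survival_iterate_ge\<close> still leaves room for it.\<close>

lemma log_rate_survival:
  assumes q: "\<And>n. 0 \<le> q n" "\<And>n. q n \<le> 1" and rate: "log_rate q (- l)" and l: "ln m \<le> l"
  shows "log_rate (\<lambda>n. 1 - (pgf p ^^ n) (1 - q n)) (ln m - l)"
proof (rule log_rateI)
  fix e :: real assume e: "e > 0"
  show "\<forall>\<^sub>F n in sequentially. 1 - (pgf p ^^ n) (1 - q n) \<le> exp (real n * (ln m - l + e))"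
    using log_rateD(2)[OF rate e]
  proof eventually_elim
    case (elim n)
    have "1 - (pgf p ^^ n) (1 - q n) \<le> m ^ n * q n" using q by (intro survival_iterate_le)
    also have "\<dots> \<le> m ^ n * exp (real n * (- l + e))"
      using elim mean_gt_1 by (intro mult_left_mono) auto
    also have "\<dots> = exp (real n * (ln m - l + e))"
      using mean_gt_1 by (simp add: algebra_simps exp_add exp_diff exp_minus exp_of_nat_mult)
    finally show ?case .
  qed
  \<comment> \<open>Half of \<open>e\<close> pays for \<open>c < m\<close>, the other half for the
    rate of \<open>q n\<close>; the bound \<open>ln m\<close> on \<open>d\<close> ensures
    \<open>c \<ge> 1\<close>.\<close>
  define d where "d = min (e / 2) (ln m)"
  define c where "c = exp (ln m - d)"
  have d: "0 < d" "d \<le> e / 2" "d \<le> ln m" using e ln_mean_pos by (auto simp: d_def)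
  have "c < exp (ln m)" unfolding c_def exp_less_cancel_iff using d by simp
  then have c: "1 \<le> c" "c < m" using d mean_gt_1 by (auto simp: c_def)
  obtain \<delta> where \<delta>: "0 < \<delta>" "\<delta> < 1"
    "\<And>s n. 0 \<le> s \<Longrightarrow> s \<le> 1 \<Longrightarrow> min \<delta> (c ^ n * s) \<le> 1 - (pgf p ^^ n) (1 - s)"
    using survival_iterate_ge[OF c] by blast
  \<comment> \<open>Since \<open>ln m - l \<le> 0\<close>, the target is at most
    \<open>exp (- n * e)\<close>, which eventually lies below the cap.\<close>
  have "\<forall>\<^sub>F n in sequentially. exp (real n * - e) \<le> \<delta>"
  proof -
    have "(\<lambda>n. exp (real n * - e)) \<longlonglongrightarrow> 0" using e by real_asymp
    then show ?thesis using \<delta>(1) by (auto dest!: order_tendstoD(2) elim: eventually_mono)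
  qed
  moreover have "\<forall>\<^sub>F n in sequentially. exp (real n * (- l - e / 2)) \<le> q n"
    using e by (intro log_rateD(1)[OF rate]) auto
  ultimately show "\<forall>\<^sub>F n in sequentially. exp (real n * (ln m - l - e)) \<le> 1 - (pgf p ^^ n) (1 - q n)"
  proof eventually_elim
    case (elim n)
    have "exp (real n * (ln m - l - e)) \<le> exp (real n * - e)"
      unfolding exp_le_cancel_iff using l by (intro mult_left_mono) auto
    also have "\<dots> \<le> \<delta>" by fact
    finally have 1: "exp (real n * (ln m - l - e)) \<le> \<delta>" .
    have "exp (real n * (ln m - l - e)) \<le> exp (real n * (ln m - d + (- l - e / 2)))"
      unfolding exp_le_cancel_iff using d by (intro mult_left_mono) auto
    also have "\<dots> = c ^ n * exp (real n * (- l - e / 2))"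
      by (simp add: c_def exp_of_nat_mult[symmetric] exp_add[symmetric] algebra_simps)
    also have "\<dots> \<le> c ^ n * q n" using elim c by (intro mult_left_mono) auto
    finally show ?case using 1 \<delta>(3)[of "q n" n] q[of n] by linarith
  qed
qed

text \<open>The double logarithm counts the generations that remain once the iterate has left the
  neighbourhood of 1; constants, and factors linear in \<open>n\<close>, in front of
  \<open>k ^ (n - j)\<close> contribute only \<open>o(n)\<close>. The hypothesis on \<open>C\<close>
  makes \<open>\<bar>ln (1 - q n)\<bar>\<close> at most linear, which covers the case that
  \<open>q n\<close> approaches 1.\<close>

lemma log_log_pgf_iterate_asymp:
  assumes q: "\<And>n. 0 \<le> q n" "\<And>n. q n \<le> 1" and rate: "log_rate q (- l)"
    and l: "0 \<le> l" "l < ln m"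
    and C: "\<forall>\<^sub>F n in sequentially. exp (- C * real n) \<le> 1 - q n"
  shows "(\<lambda>n. ln \<bar>ln ((pgf p ^^ n) (1 - q n))\<bar>) \<sim>[sequentially]
    (\<lambda>n. real n * ln (real k) * (1 - l / ln m))"
proof -
  define F where "F n = (pgf p ^^ n) (1 - q n)" for n
  define \<theta> where "\<theta> = l / ln m"
  have \<theta>: "0 \<le> \<theta>" "\<theta> < 1" "l = \<theta> * ln m" using l ln_mean_pos by (auto simp: \<theta>_def)
  have F_split: "F n = (pgf p ^^ (n - j)) ((pgf p ^^ j) (1 - q n))" if "j \<le> n" for n j
    using that unfolding F_def by (metis add_diff_cancel_right' comp_apply funpow_add le_add_diff_inverse2)
  have F_range: "0 \<le> (pgf p ^^ j) (1 - q n) \<and> (pgf p ^^ j) (1 - q n) \<le> 1" for j n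
    using q by (intro pgf_iterate_range) auto

  \<comment> \<open>generations \<open>1..j\<close> bring the argument down from \<open>1 - q n\<close> to a constant below 1\<close>
  have lower: "\<forall>\<^sub>F n in sequentially. F n > 0 \<longrightarrow>
      (1 - \<theta> - 2 * \<eta>) * real n * ln (real k) \<le> ln \<bar>ln (F n)\<bar>"
    if \<eta>: "0 < \<eta>" "\<eta> < 1 - \<theta>" for \<eta>
  proof -
    \<comment> \<open>As \<open>c\<close> is smaller than \<open>m\<close>, a fraction \<eta> of
      additional generations is spent near 1. The slack \<open>e\<close> below is the solution of
      \<open>(\<theta> + \<eta>) * (1 - \<eta> / 2) * ln m = l + e\<close>, which gives
      \<open>c ^ j * q n \<ge> 1\<close>.\<close>
    define c where "c = exp ((1 - \<eta> / 2) * ln m)"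
    define e where "e = ln m * \<eta> * (1 - \<theta> / 2 - \<eta> / 2)"
    have e: "e > 0" unfolding e_def using \<eta> \<theta> ln_mean_pos by (intro mult_pos_pos) auto
    have "(1 - \<eta> / 2) * ln m < 1 * ln m" using \<eta> ln_mean_pos by (intro mult_strict_right_mono) auto
    then have "c < exp (ln m)" unfolding c_def exp_less_cancel_iff by simp
    then have c: "1 \<le> c" "c < m" using \<eta> \<theta> mean_gt_1 ln_mean_pos by (auto simp: c_def)
    obtain \<delta> where \<delta>: "0 < \<delta>" "\<delta> < 1"
      "\<And>s n. 0 \<le> s \<Longrightarrow> s \<le> 1 \<Longrightarrow> min \<delta> (c ^ n * s) \<le> 1 - (pgf p ^^ n) (1 - s)"
      using survival_iterate_ge[OF c] by blast
    define D where "D = - ln (1 - \<delta>)"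
    have D: "D > 0" using \<delta> by (simp add: D_def)
    \<comment> \<open>The second \<eta> of \<open>2 * \<eta>\<close> absorbs the generation lost by
      rounding \<open>j\<close> up, and the constant \<open>D\<close>.\<close>
    have "\<forall>\<^sub>F n in sequentially. ln (real k) - ln D \<le> \<eta> * real n * ln (real k)"
      using \<eta> ln_kstar_pos by real_asymp
    with log_rateD(1)[OF rate e] show ?thesis
    proof eventually_elim
      case (elim n)
      define j where "j = nat \<lceil>real n * (\<theta> + \<eta>)\<rceil>"
      have "real n * (\<theta> + \<eta>) \<le> real n * 1" using \<eta> by (intro mult_left_mono) auto
      then have jn: "j \<le> n" unfolding j_def by linarith
      have j: "real n * (\<theta> + \<eta>) \<le> real j" "real j \<le> real n * (\<theta> + \<eta>) + 1"
        using \<theta> \<eta> unfolding j_def by (auto simp: of_nat_ceiling)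
      have "1 \<le> exp (0::real)" by simp
      also have "0 = (real n * (\<theta> + \<eta>)) * ((1 - \<eta> / 2) * ln m) + real n * (- l - e)"
        unfolding \<theta>(3) e_def by (simp add: algebra_simps)
      also have "exp \<dots> \<le> exp (real j * ((1 - \<eta> / 2) * ln m) + real n * (- l - e))"
        unfolding exp_le_cancel_iff using j \<eta> \<theta> ln_mean_pos
        by (intro add_right_mono mult_right_mono) auto
      also have "\<dots> = c ^ j * exp (real n * (- l - e))"
        by (simp add: c_def exp_add exp_of_nat_mult)
      also have "\<dots> \<le> c ^ j * q n" using elim c by (intro mult_left_mono) auto
      finally have "\<delta> \<le> 1 - (pgf p ^^ j) (1 - q n)" using \<delta>(2) \<delta>(3)[of "q n" j] q[of n] by linarith
      then have "F n \<le> (1 - \<delta>) ^ (k ^ (n - j))"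
        using F_range[of j n] pgf_iterate_le_power[of "(pgf p ^^ j) (1 - q n)" "n - j"]
          power_mono[of "(pgf p ^^ j) (1 - q n)" "1 - \<delta>" "k ^ (n - j)"]
        unfolding F_split[OF jn] by linarith
      show ?case
      proof
        \<comment> \<open>With \<open>F n = 0\<close> the convention \<open>ln 0 = 0\<close> would
          turn the double logarithm into 0. Positivity is delivered by \<open>upper\<close>.\<close>
        assume "F n > 0"
        with \<open>F n \<le> _\<close> have "ln (F n) \<le> ln ((1 - \<delta>) ^ (k ^ (n - j)))"
          by (intro ln_mono) auto
        also have "\<dots> = - (real k ^ (n - j) * D)" using \<delta> by (simp add: D_def ln_realpow)
        finally have "real k ^ (n - j) * D \<le> \<bar>ln (F n)\<bar>" by linarith
        moreover have "0 < real k ^ (n - j) * D" using D kstar_gt_1 by simp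
        ultimately have "ln (real k ^ (n - j) * D) \<le> ln \<bar>ln (F n)\<bar>" by (intro ln_mono) auto
        moreover have "ln (real k ^ (n - j) * D) = (real n - real j) * ln (real k) + ln D"
          using D kstar_gt_1 jn by (simp add: ln_mult ln_realpow of_nat_diff)
        moreover have "(real n - (real n * (\<theta> + \<eta>) + 1)) * ln (real k) \<le> (real n - real j) * ln (real k)"
          using j ln_kstar_pos by (intro mult_right_mono) auto
        ultimately show "(1 - \<theta> - 2 * \<eta>) * real n * ln (real k) \<le> ln \<bar>ln (F n)\<bar>"
          using elim(2) by (simp add: algebra_simps)
      qed
    qed
  qed

  \<comment> \<open>generations \<open>1..j\<close> leave the argument above \<open>1 / 2\<close>; if \<open>\<theta> = 0\<close> there are none of them,
    and the lower bound on \<open>1 - q n\<close> is used instead\<close>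
  have upper: "\<forall>\<^sub>F n in sequentially. 0 < F n \<and> (F n < 1 \<longrightarrow>
      ln \<bar>ln (F n)\<bar> \<le> (1 - \<theta> + 2 * \<eta>) * real n * ln (real k))"
    if \<eta>: "0 < \<eta>" for \<eta>
  proof -
    \<comment> \<open>One exponent for both cases: \<open>C\<close> serves when no generation is
      spent near 1, and a positive value makes \<open>exp (- B * n)\<close> fall below
      \<open>1 / 2\<close> in the other case.\<close>
    define B where "B = max C 1"
    define D where "D = - ln (pmf p k)"
    have D: "D \<ge> 0" using pmf_kstar pmf_le_1[of p k] by (simp add: D_def)
    \<comment> \<open>For \<open>\<theta> \<le> \<eta>\<close> the rounded exponent is 0 and the
      product is \<open>q n\<close> itself, which need not be at most \<open>1 / 2\<close>.\<close>
    have "\<forall>\<^sub>F n in sequentially. m ^ nat \<lfloor>real n * (\<theta> - \<eta>)\<rfloor> * q n \<le> 1 / 2 \<or> \<theta> \<le> \<eta>"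
    proof (cases "\<theta> \<le> \<eta>")
      case False
      have "\<forall>\<^sub>F n in sequentially. exp (real n * - (\<eta> * ln m / 2)) < 1 / 2"
      proof (rule order_tendstoD(2))
        show "(\<lambda>n. exp (real n * - (\<eta> * ln m / 2))) \<longlonglongrightarrow> 0"
          using \<eta> ln_mean_pos by real_asymp
      qed auto
      moreover have "\<eta> * ln m / 2 > 0" using \<eta> ln_mean_pos by simp
      note log_rateD(2)[OF rate this]
      ultimately show ?thesis
      proof eventually_elim
        case (elim n)
        define j where "j = nat \<lfloor>real n * (\<theta> - \<eta>)\<rfloor>"
        have j: "real j \<le> real n * (\<theta> - \<eta>)" unfolding j_def
          using False by (intro of_nat_floor mult_nonneg_nonneg) auto
        have "m ^ j * q n \<le> m ^ j * exp (real n * (- l + \<eta> * ln m / 2))"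
          using elim mean_gt_1 by (intro mult_left_mono) auto
        also have "\<dots> = exp (real j * ln m + real n * (- l + \<eta> * ln m / 2))"
          using mean_gt_1 by (simp add: exp_add exp_of_nat_mult)
        also have "\<dots> \<le> exp (real n * (\<theta> - \<eta>) * ln m + real n * (- l + \<eta> * ln m / 2))"
          unfolding exp_le_cancel_iff using j ln_mean_pos
          by (intro add_right_mono mult_right_mono) auto
        also have "\<dots> = exp (real n * - (\<eta> * ln m / 2))"
          unfolding \<theta>(3) by (simp add: algebra_simps)
        finally show ?case using elim unfolding j_def by linarith
      qed
    qed auto
    moreover have "\<forall>\<^sub>F n in sequentially. exp (- B * real n) \<le> 1 / 2"
    proof -
      have "B > 0" by (simp add: B_def)
      then show ?thesis by real_asymp
    qed
    moreover have "\<forall>\<^sub>F n in sequentially. ln (real k) + ln (B * real n + D) \<le> \<eta> * real n * ln (real k)"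
    proof -
      have "B > 0" by (simp add: B_def)
      then show ?thesis using \<eta> ln_kstar_pos by real_asymp
    qed
    ultimately show ?thesis using C eventually_gt_at_top[of 0]
    proof eventually_elim
      case (elim n)
      define j where "j = nat \<lfloor>real n * (\<theta> - \<eta>)\<rfloor>"
      have "real n * (\<theta> - \<eta>) \<le> real n * 1" using \<theta> \<eta> by (intro mult_left_mono) auto
      then have jn: "j \<le> n" unfolding j_def by linarith
      have j: "real n * (\<theta> - \<eta>) - 1 \<le> real j" unfolding j_def by linarith
      define v where "v = (pgf p ^^ j) (1 - q n)"
      have v: "exp (- B * real n) \<le> v"
      proof (cases "\<theta> \<le> \<eta>")
        case True
        then have "real n * (\<theta> - \<eta>) \<le> 0" by (simp add: mult_le_0_iff)
        then have "j = 0" unfolding j_def by simp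
        have "- B * real n \<le> - C * real n" unfolding B_def by (simp add: mult_right_mono)
        then have "exp (- B * real n) \<le> exp (- C * real n)" by simp
        also have "\<dots> \<le> v" using elim \<open>j = 0\<close> by (simp add: v_def)
        finally show ?thesis .
      next
        case False
        then have "1 - v \<le> 1 / 2"
          using survival_iterate_le[of "q n" j] q[of n] elim(1) unfolding v_def j_def by linarith
        with elim show ?thesis by linarith
      qed
      have v01: "0 \<le> v" "v \<le> 1" unfolding v_def using F_range by auto
      have w: "0 < pmf p k * exp (- B * real n)" using pmf_kstar by simp
      have "(pmf p k * exp (- B * real n)) ^ (k ^ (n - j)) \<le> (pmf p k * v) ^ (k ^ (n - j))"
        using v w by (intro power_mono mult_left_mono) auto
      also have "\<dots> \<le> F n" unfolding F_split[OF jn] v_def[symmetric]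
        by (rule power_le_pgf_iterate[OF v01])
      finally have F: "(pmf p k * exp (- B * real n)) ^ (k ^ (n - j)) \<le> F n" .
      then have pos: "0 < F n" using zero_less_power[OF w] less_le_trans by blast
      moreover have "ln \<bar>ln (F n)\<bar> \<le> (1 - \<theta> + 2 * \<eta>) * real n * ln (real k)" if "F n < 1"
      proof -
        have "ln ((pmf p k * exp (- B * real n)) ^ (k ^ (n - j))) \<le> ln (F n)"
          using F w by (intro ln_mono) auto
        moreover have "ln ((pmf p k * exp (- B * real n)) ^ (k ^ (n - j))) =
            - (real k ^ (n - j) * (B * real n + D))"
          using w pmf_kstar by (simp add: ln_realpow ln_mult D_def algebra_simps)
        moreover have neg: "ln (F n) < 0" using pos that by simp
        ultimately have *: "\<bar>ln (F n)\<bar> \<le> real k ^ (n - j) * (B * real n + D)" by linarith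
        have BD: "0 < B * real n + D"
          using elim D by (intro add_pos_nonneg mult_pos_pos) (auto simp: B_def)
        have "ln \<bar>ln (F n)\<bar> \<le> ln (real k ^ (n - j) * (B * real n + D))"
          using * neg by (intro ln_mono) auto
        also have "\<dots> = (real n - real j) * ln (real k) + ln (B * real n + D)"
          using BD kstar_gt_1 jn by (simp add: ln_mult ln_realpow of_nat_diff)
        also have "(real n - real j) * ln (real k) \<le> (real n - (real n * (\<theta> - \<eta>) - 1)) * ln (real k)"
          using j ln_kstar_pos by (intro mult_right_mono) auto
        finally show ?thesis using elim(3) by (simp add: algebra_simps)
      qed
      ultimately show ?case by blast
    qed
  qed

  have F_less_1: "\<forall>\<^sub>F n in sequentially. F n < 1"
    using log_rateD(1)[OF rate zero_less_one]
  proof eventually_elim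
    case (elim n)
    then have "0 < q n" by (meson exp_gt_zero less_le_trans)
    have "F n \<le> (1 - q n) ^ (k ^ n)" unfolding F_def using q by (intro pgf_iterate_le_power) auto
    also have "\<dots> \<le> (1 - q n) ^ 1"
      using q kstar_ge_2 by (intro power_decreasing) (auto simp: Suc_le_eq)
    finally show ?case using \<open>0 < q n\<close> by simp
  qed

  have "(\<lambda>n. ln \<bar>ln (F n)\<bar>) \<sim>[sequentially] (\<lambda>n. real n * (ln (real k) * (1 - \<theta>)))"
  proof (rule asymp_equiv_linearI)
    show "0 < ln (real k) * (1 - \<theta>)" using \<theta> ln_kstar_pos by simp
  next
    fix e assume e: "0 < e" "e < ln (real k) * (1 - \<theta>)"
    define \<eta> where "\<eta> = e / (2 * ln (real k))"
    have \<eta>: "0 < \<eta>" "\<eta> < 1 - \<theta>" "e = 2 * \<eta> * ln (real k)"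
      using e ln_kstar_pos \<theta> by (auto simp: \<eta>_def field_simps)
    show "\<forall>\<^sub>F n in sequentially. real n * (ln (real k) * (1 - \<theta>) - e) \<le> ln \<bar>ln (F n)\<bar>"
      using lower[OF \<eta>(1,2)] upper[OF \<eta>(1)]
      by eventually_elim (simp add: \<eta>(3) algebra_simps)
    show "\<forall>\<^sub>F n in sequentially. ln \<bar>ln (F n)\<bar> \<le> real n * (ln (real k) * (1 - \<theta>) + e)"
      using upper[OF \<eta>(1)] F_less_1
    proof eventually_elim
      case (elim n)
      then have "ln \<bar>ln (F n)\<bar> \<le> (1 - \<theta> + 2 * \<eta>) * real n * ln (real k)" by blast
      also have "\<dots> = real n * (ln (real k) * (1 - \<theta>) + e)" by (simp add: \<eta>(3) algebra_simps)
      finally show ?case .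
    qed
  qed
  then show ?thesis by (simp add: F_def \<theta>_def mult.assoc)
qed

text \<open>Divided by \<open>k ^ n\<close>, the two power bounds enclose \<open>- ln\<close> of the
  iterate between \<open>- ln (w n)\<close> and the same plus the constant \<open>D\<close>, which
  is negligible against the linear growth in \<open>n\<close>.\<close>

lemma log_pgf_iterate_asymp:
  assumes w: "\<And>n. 0 \<le> w n" "\<And>n. w n \<le> 1" and rate: "log_rate w (- l)" and l: "0 < l"
  shows "(\<lambda>n. ln ((pgf p ^^ n) (w n))) \<sim>[sequentially] (\<lambda>n. - real n * real k ^ n * l)"
proof -
  define D where "D = - ln (pmf p k)"
  have bounds: "\<forall>\<^sub>F n in sequentially.
      - ln (w n) \<le> - ln ((pgf p ^^ n) (w n)) / real k ^ n \<and>
      - ln ((pgf p ^^ n) (w n)) / real k ^ n \<le> D - ln (w n)"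
    using log_rateD(1)[OF rate zero_less_one]
  proof eventually_elim
    case (elim n)
    have pos: "0 < w n" using elim by (meson exp_gt_zero less_le_trans)
    have *: "(pmf p k * w n) ^ (k ^ n) \<le> (pgf p ^^ n) (w n)" "(pgf p ^^ n) (w n) \<le> w n ^ (k ^ n)"
      using w by (auto intro!: power_le_pgf_iterate pgf_iterate_le_power)
    moreover have **: "0 < (pmf p k * w n) ^ (k ^ n)" using pos pmf_kstar by simp
    ultimately have "ln ((pmf p k * w n) ^ (k ^ n)) \<le> ln ((pgf p ^^ n) (w n))"
      "ln ((pgf p ^^ n) (w n)) \<le> ln (w n ^ (k ^ n))"
      by (auto intro!: ln_mono)
    moreover have "ln ((pmf p k * w n) ^ (k ^ n)) = real k ^ n * (ln (w n) - D)"
      using pos pmf_kstar by (simp add: ln_realpow ln_mult D_def)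
    moreover have "ln (w n ^ (k ^ n)) = real k ^ n * ln (w n)"
      using pos by (simp add: ln_realpow)
    moreover have "0 < real k ^ n" using kstar_gt_1 by simp
    ultimately show ?case by (simp add: field_simps)
  qed
  have "(\<lambda>n. - ln ((pgf p ^^ n) (w n)) / real k ^ n) \<sim>[sequentially] (\<lambda>n. real n * l)"
  proof (rule asymp_equiv_linearI[OF l])
    fix e :: real assume e: "0 < e" "e < l"
    show "\<forall>\<^sub>F n in sequentially. real n * (l - e) \<le> - ln ((pgf p ^^ n) (w n)) / real k ^ n"
      using bounds log_rateD(2)[OF rate e(1)] log_rateD(1)[OF rate e(1)]
    proof eventually_elim
      case (elim n)
      have "0 < w n" using elim(3) by (meson exp_gt_zero less_le_trans)
      then have "ln (w n) \<le> real n * (- l + e)" using elim by (simp add: ln_le_iff)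
      then show ?case using elim(1) by (simp add: algebra_simps)
    qed
    have e2: "e / 2 > 0" using e by simp
    have "\<forall>\<^sub>F n in sequentially. D \<le> real n * (e / 2)" using e by real_asymp
    then show "\<forall>\<^sub>F n in sequentially. - ln ((pgf p ^^ n) (w n)) / real k ^ n \<le> real n * (l + e)"
      using bounds log_rateD(1)[OF rate e2]
    proof eventually_elim
      case (elim n)
      have "0 < w n" using elim(3) by (meson exp_gt_zero less_le_trans)
      then have "real n * (- l - e / 2) \<le> ln (w n)" using elim by (simp add: ln_ge_iff)
      then show ?case using elim by (simp add: algebra_simps)
    qed
  qed
  then have "(\<lambda>n. - (real k ^ n * (- ln ((pgf p ^^ n) (w n)) / real k ^ n))) \<sim>[sequentially]
      (\<lambda>n. - (real k ^ n * (real n * l)))"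
    by (intro asymp_equiv_intros)
  moreover have "k \<noteq> 0" using kstar_ge_2 by linarith
  ultimately show ?thesis by (simp add: mult_ac)
qed

end

subsection \<open>Stretched exponential tails\<close>

text \<open>This is \<open>- ln (measure D {y..}) \<sim> l * y powr r\<close> for
  \<open>l > 0\<close>, as inequalities that avoid the logarithm of a vanishing tail. On this scale
  a slowly varying factor is invisible.\<close>

definition stretched_tail :: "real measure \<Rightarrow> real \<Rightarrow> real \<Rightarrow> bool" where
  "stretched_tail D l r \<longleftrightarrow> (\<forall>e>0. \<forall>\<^sub>F y in at_top.
     exp (- (l + e) * y powr r) \<le> measure D {y..} \<and> measure D {y..} \<le> exp (- (l - e) * y powr r))"

text \<open>The increments of \<open>ln (a (t ^ i))\<close> tend to 0, so they are eventually below
  1. The resulting linear growth in \<open>i\<close> loses against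
  \<open>l * (t ^ i) powr r\<close>, which is exponential in \<open>i\<close>.\<close>

lemma slowly_varying_ln_geometric:
  assumes a: "slowly_varying a" and t: "t > 1"
  shows "\<exists>C. \<forall>\<^sub>F i in sequentially. 0 < a (t ^ i) \<and> \<bar>ln (a (t ^ i))\<bar> \<le> C + real i"
proof -
  have lim: "filterlim (\<lambda>i. t ^ i) at_top sequentially"
    using t by real_asymp
  obtain A where A: "\<And>x. x \<ge> A \<Longrightarrow> a x > 0" using a by (auto simp: slowly_varying_def)
  have pos: "\<forall>\<^sub>F i in sequentially. a (t ^ i) > 0"
    using lim A by (auto simp: filterlim_at_top elim!: allE[of _ A] eventually_mono)
  have "((\<lambda>x. a (t * x) / a x) \<longlongrightarrow> 1) at_top" using a t by (auto simp: slowly_varying_def)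
  then have "(\<lambda>i. a (t * t ^ i) / a (t ^ i)) \<longlonglongrightarrow> 1"
    using lim by (rule filterlim_compose)
  then have "(\<lambda>i. ln (a (t * t ^ i) / a (t ^ i))) \<longlonglongrightarrow> ln 1"
    by (intro tendsto_ln) auto
  then have "\<forall>\<^sub>F i in sequentially. \<bar>ln (a (t * t ^ i) / a (t ^ i))\<bar> < 1"
    by (auto dest!: tendstoD[of _ _ _ 1])
  with pos have "\<forall>\<^sub>F i in sequentially. 0 < a (t ^ i) \<and> \<bar>ln (a (t * t ^ i) / a (t ^ i))\<bar> < 1"
    by (rule eventually_conj)
  then obtain I where I: "\<And>i. i \<ge> I \<Longrightarrow> 0 < a (t ^ i)"
    "\<And>i. i \<ge> I \<Longrightarrow> \<bar>ln (a (t * t ^ i) / a (t ^ i))\<bar> < 1"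
    by (auto simp: eventually_sequentially)
  have "\<bar>ln (a (t ^ i))\<bar> \<le> \<bar>ln (a (t ^ I))\<bar> + real i" if "i \<ge> I" for i
    using that
  proof (induction i rule: dec_induct)
    case (step i)
    have "ln (a (t * t ^ i) / a (t ^ i)) = ln (a (t ^ Suc i)) - ln (a (t ^ i))"
      using I(1)[of i] I(1)[of "Suc i"] step by (simp add: ln_div)
    then show ?case using I(2)[of i] step by simp
  qed auto
  with I(1) show ?thesis
    unfolding eventually_sequentially by blast
qed

text \<open>
  Monotonicity of the tail reduces the claim to the points \<open>t ^ i\<close> with \<open>t\<close> close to 1,
  so that no uniform convergence theorem for slowly varying functions is needed.
\<close>

lemma stretched_tailI:
  assumes D: "real_distribution D" and a: "slowly_varying a" and l: "0 < l" and r: "0 < r"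
    and tail: "\<And>x. 0 \<le> x \<Longrightarrow> measure D {x..} = a x * exp (- l * x powr r)"
  shows "stretched_tail D l r"
  unfolding stretched_tail_def
proof (intro allI impI)
  fix e :: real assume e: "e > 0"
  interpret real_distribution D by fact
  define T where "T x = measure D {x..}" for x
  have mono: "T y \<le> T x" if "x \<le> y" for x y
    unfolding T_def using that by (intro finite_measure_mono) auto
  \<comment> \<open>One factor \<open>1 + \<eta>\<close> pays for the slowly varying part, another
    for the gap between neighbouring grid points:
    \<open>(1 + \<eta>)\<twosuperior> \<le> 1 + 3 * \<eta>\<close> explains the 3, and
    \<open>1 / 2\<close> keeps \<open>1 - 2 * \<eta>\<close> nonnegative. The choice of
    \<open>t\<close> makes the powers \<open>(t ^ i) powr r\<close> geometric with ratio
    \<open>1 + \<eta>\<close>.\<close>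
  define \<eta> where "\<eta> = min (1 / 2) (e / (3 * l))"
  define s where "s = 1 + \<eta>"
  define t where "t = s powr (1 / r)"
  have \<eta>: "0 < \<eta>" "\<eta> \<le> 1 / 2" "3 * l * \<eta> \<le> e"
    using e l by (auto simp: \<eta>_def min_def field_simps)
  have s: "s > 1" using \<eta> by (simp add: s_def)
  have t: "t > 1" unfolding t_def using s r by (intro gr_one_powr) auto
  have t_powr: "(t ^ i) powr r = s ^ i" for i
  proof -
    have "(t ^ i) powr r = (t powr r) powr real i"
      using t by (simp add: powr_realpow[symmetric] powr_powr mult.commute)
    also have "t powr r = s" using s r by (simp add: t_def powr_powr)
    finally show ?thesis using s by (simp add: powr_realpow)
  qed
  obtain C where C: "\<forall>\<^sub>F i in sequentially. 0 < a (t ^ i) \<and> \<bar>ln (a (t ^ i))\<bar> \<le> C + real i"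
    using slowly_varying_ln_geometric[OF a t] by blast
  moreover have "\<forall>\<^sub>F i in sequentially. C + real i \<le> l * \<eta> * s ^ i"
    using l \<eta> s by real_asymp
  ultimately have "\<forall>\<^sub>F i in sequentially.
      exp (- l * (1 + \<eta>) * s ^ i) \<le> T (t ^ i) \<and> T (t ^ i) \<le> exp (- l * (1 - \<eta>) * s ^ i)"
  proof eventually_elim
    case (elim i)
    have "T (t ^ i) = a (t ^ i) * exp (- l * s ^ i)"
      using tail[of "t ^ i"] t by (simp add: T_def t_powr)
    also have "\<dots> = exp (ln (a (t ^ i)) - l * s ^ i)"
      using elim by (simp add: exp_diff exp_minus field_simps)
    finally show ?case using elim by (auto simp: algebra_simps)
  qed
  then obtain K where K: "\<And>i. i \<ge> K \<Longrightarrow>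
      exp (- l * (1 + \<eta>) * s ^ i) \<le> T (t ^ i) \<and> T (t ^ i) \<le> exp (- l * (1 - \<eta>) * s ^ i)"
    by (auto simp: eventually_sequentially)
  show "\<forall>\<^sub>F y in at_top. exp (- (l + e) * y powr r) \<le> measure D {y..} \<and>
      measure D {y..} \<le> exp (- (l - e) * y powr r)"
    using eventually_ge_at_top[of "t ^ K"]
  proof eventually_elim
    case (elim y)
    obtain n where n: "y < t ^ n" using real_arch_pow[OF t] by blast
    define N where "N = (LEAST n. y < t ^ n)"
    have N: "y < t ^ N" unfolding N_def using n by (rule LeastI)
    have "t ^ K < t ^ N" using elim N by linarith
    then have "K < N" using t by simp
    then obtain i where i: "N = Suc i" "K \<le> i" by (cases N) auto
    have "\<not> y < t ^ i" using not_less_Least[of i "\<lambda>n. y < t ^ n"] i by (auto simp: N_def[symmetric])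
    then have y: "t ^ i \<le> y" "y \<le> t ^ Suc i" using N i by auto
    have y0: "0 < y" using y t by (meson less_le_trans zero_less_one zero_less_power less_trans)
    have yr: "s ^ i \<le> y powr r" "y powr r \<le> s ^ Suc i"
      using powr_mono2[OF _ _ y(1), of r] powr_mono2[OF _ _ y(2), of r] r t y0 by (auto simp only: t_powr) auto
    have "- (l + e) * y powr r \<le> - l * (1 + \<eta>) * s ^ Suc i"
    proof -
      have "(1 + \<eta>) * s ^ Suc i = (1 + \<eta>) * s * s ^ i" by simp
      also have "\<dots> \<le> (1 + \<eta>) * s * y powr r" using yr \<eta> s by (intro mult_left_mono) auto
      finally have "l * ((1 + \<eta>) * s ^ Suc i) \<le> l * ((1 + \<eta>) * s * y powr r)"
        using l by (intro mult_left_mono) auto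
      moreover have "l * ((1 + \<eta>) * s) \<le> l + e"
      proof -
        have "\<eta> * \<eta> \<le> \<eta> * 1" using \<eta> by (intro mult_left_mono) auto
        then have "(1 + \<eta>) * s \<le> 1 + 3 * \<eta>" by (simp add: s_def algebra_simps)
        then have "l * ((1 + \<eta>) * s) \<le> l * (1 + 3 * \<eta>)" using l by (intro mult_left_mono) auto
        then show ?thesis using \<eta> by (simp add: algebra_simps)
      qed
      then have "l * ((1 + \<eta>) * s) * y powr r \<le> (l + e) * y powr r" by (intro mult_right_mono) auto
      ultimately show ?thesis by (simp add: algebra_simps)
    qed
    then have "exp (- (l + e) * y powr r) \<le> exp (- l * (1 + \<eta>) * s ^ Suc i)"
      unfolding exp_le_cancel_iff .
    also have "\<dots> \<le> T (t ^ Suc i)" using K[of "Suc i"] i by simp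
    also have "\<dots> \<le> T y" by (rule mono) (rule y)
    finally have lower: "exp (- (l + e) * y powr r) \<le> T y" .
    have "- l * (1 - \<eta>) * s ^ i \<le> - (l - e) * y powr r"
    proof -
      have "(l - e) * y powr r \<le> l * (1 - 2 * \<eta>) * y powr r"
        using \<eta> l e by (intro mult_right_mono) (auto simp: algebra_simps)
      also have "\<dots> \<le> l * (1 - 2 * \<eta>) * s ^ Suc i"
        using yr l \<eta> by (intro mult_left_mono mult_nonneg_nonneg) auto
      also have "\<dots> = l * ((1 - 2 * \<eta>) * s) * s ^ i" by simp
      also have "\<dots> \<le> l * (1 - \<eta>) * s ^ i"
        using l s \<eta> by (intro mult_right_mono mult_left_mono) (auto simp: s_def algebra_simps)
      finally show ?thesis by (simp only: mult_minus_left neg_le_iff_le)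
    qed
    then have "exp (- l * (1 - \<eta>) * s ^ i) \<le> exp (- (l - e) * y powr r)"
      unfolding exp_le_cancel_iff .
    moreover have "T y \<le> T (t ^ i)" by (rule mono) (rule y)
    ultimately have "T y \<le> exp (- (l - e) * y powr r)" using K[of i] i by linarith
    with lower show ?case by (simp add: T_def)
  qed
qed

text \<open>Layers according to the integer part of \<open>max u 0 powr r\<close>: at level
  \<open>k\<close> the integrand is at most \<open>exp (\<mu> * (k + 1))\<close>, while the level is
  reached with probability about \<open>exp (- l * k)\<close>. Since \<open>\<mu> < l\<close>, a
  geometric series dominates.\<close>

lemma (in real_distribution) integrable_stretched_exp:
  assumes tail: "stretched_tail M l r" and r: "0 < r" and \<mu>: "0 \<le> \<mu>" "\<mu> < l"
  shows "integrable M (\<lambda>u. exp (\<mu> * max u 0 powr r))"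
proof (rule integrableI_bounded)
  \<comment> \<open>With \<open>max u 0\<close> and \<open>0 powr (1 / r) = 0\<close>, the set
    \<open>A 0\<close> is the whole line, so negative \<open>u\<close> are covered as well.\<close>
  define A where "A k = {u. real k powr (1 / r) \<le> max u 0}" for k :: nat
  have A [measurable]: "A k \<in> sets borel" for k unfolding A_def by measurable
  define f where "f k = exp (\<mu> * (real k + 1)) * prob (A k)" for k
  \<comment> \<open>Half of the gap goes to the tail estimate; the other half remains as the
    exponent of the ratio \<open>exp (- e)\<close>.\<close>
  define e where "e = (l - \<mu>) / 2"
  have e: "e > 0" using \<mu> by (simp add: e_def)
  have "\<forall>\<^sub>F y in at_top. prob {y..} \<le> exp (- (l - e) * y powr r)"
    using tail[unfolded stretched_tail_def, rule_format, OF e] by (rule eventually_mono) auto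
  moreover have "filterlim (\<lambda>k. real k powr (1 / r)) at_top sequentially"
    using r by real_asymp
  ultimately have "\<forall>\<^sub>F k in sequentially.
      prob {real k powr (1 / r)..} \<le> exp (- (l - e) * (real k powr (1 / r)) powr r)"
    by (auto simp: filterlim_iff)
  then have "\<forall>\<^sub>F k in sequentially. norm (f k) \<le> exp \<mu> * exp (- e) ^ k"
    using eventually_gt_at_top[of 0]
  proof eventually_elim
    case (elim k)
    have "A k = {real k powr (1 / r)..}"
    proof -
      have "0 < real k powr (1 / r)" using elim(2) by simp
      then show ?thesis by (auto simp: A_def le_max_iff_disj)
    qed
    then have "f k \<le> exp (\<mu> * (real k + 1)) * exp (- (l - e) * real k)"
      using elim r unfolding f_def by (intro mult_left_mono) (auto simp: powr_powr)
    also have "\<dots> = exp \<mu> * exp (- e) ^ k"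
      by (simp add: exp_of_nat_mult[symmetric] exp_add[symmetric] e_def field_simps)
    finally show ?case by (simp add: f_def)
  qed
  then have "summable f"
    by (rule summable_comparison_test_ev)
      (use e in \<open>auto intro!: summable_mult summable_geometric\<close>)
  have "(\<integral>\<^sup>+ u. ennreal (norm (exp (\<mu> * max u 0 powr r))) \<partial>M) \<le>
      (\<integral>\<^sup>+ u. (\<Sum>k. ennreal (exp (\<mu> * (real k + 1))) * indicator (A k) u) \<partial>M)"
  proof (rule nn_integral_mono)
    fix u
    define v where "v = max u 0 powr r"
    define k where "k = nat \<lfloor>v\<rfloor>"
    have v: "0 \<le> v" "real k \<le> v" "v \<le> real k + 1" by (auto simp: v_def k_def of_nat_floor)
    have "real k powr (1 / r) \<le> v powr (1 / r)" using v r by (intro powr_mono2) auto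
    also have "\<dots> = max u 0" using r by (simp add: v_def powr_powr)
    finally have "u \<in> A k" by (simp add: A_def)
    moreover have "\<mu> * v \<le> \<mu> * (real k + 1)" using v \<mu> by (intro mult_left_mono) auto
    ultimately have "ennreal (norm (exp (\<mu> * v))) \<le>
        (\<Sum>k\<in>{k}. ennreal (exp (\<mu> * (real k + 1))) * indicator (A k) u)"
      by (auto intro!: ennreal_leI)
    also have "\<dots> \<le> (\<Sum>k. ennreal (exp (\<mu> * (real k + 1))) * indicator (A k) u)"
      by (rule sum_le_suminf) auto
    finally show "ennreal (norm (exp (\<mu> * max u 0 powr r))) \<le>
        (\<Sum>k. ennreal (exp (\<mu> * (real k + 1))) * indicator (A k) u)" unfolding v_def .
  qed
  also have "\<dots> = (\<Sum>k. \<integral>\<^sup>+ u. ennreal (exp (\<mu> * (real k + 1))) * indicator (A k) u \<partial>M)"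
    by (intro nn_integral_suminf) auto
  also have "\<dots> = (\<Sum>k. ennreal (f k))"
    by (simp add: nn_integral_cmult_indicator f_def ennreal_mult emeasure_eq_measure)
  also have "\<dots> = ennreal (\<Sum>k. f k)"
    by (rule suminf_ennreal2[OF _ \<open>summable f\<close>]) (simp add: f_def)
  also have "\<dots> < \<infinity>" by simp
  finally show "(\<integral>\<^sup>+ u. ennreal (norm (exp (\<mu> * max u 0 powr r))) \<partial>M) < \<infinity>" .
qed measurable

text \<open>
  For \<open>0 \<le> u < y\<close> the exponent \<open>\<mu> * y powr (r - 1) * u\<close> is at most \<open>\<mu> * u powr r\<close>, because
  \<open>r < 1\<close>; this gives the dominating function.
\<close>

lemma (in real_distribution) truncated_mgf_tendsto:
  assumes tail: "stretched_tail M l r" and r: "0 < r" "r < 1" and \<mu>: "0 \<le> \<mu>" "\<mu> < l"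
    and y: "filterlim y at_top sequentially"
  shows "(\<lambda>n. \<integral>u. exp (\<mu> * y n powr (r - 1) * u) * indicator {..<y n} u \<partial>M) \<longlonglongrightarrow> 1"
proof -
  have "(\<lambda>n. \<integral>u. exp (\<mu> * y n powr (r - 1) * u) * indicator {..<y n} u \<partial>M) \<longlonglongrightarrow> (\<integral>u. 1 \<partial>M)"
  proof (rule integral_dominated_convergence)
    show "integrable M (\<lambda>u. exp (\<mu> * max u 0 powr r))"
      using tail r \<mu> by (intro integrable_stretched_exp)
    have lim: "(\<lambda>n. y n powr (r - 1)) \<longlonglongrightarrow> 0"
      using r y by (intro tendsto_neg_powr) auto
    show "AE u in M. (\<lambda>n. exp (\<mu> * y n powr (r - 1) * u) * indicator {..<y n} u) \<longlonglongrightarrow> 1"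
    proof (intro AE_I2)
      fix u
      have "\<forall>\<^sub>F n in sequentially. u < y n" using y by (auto simp: filterlim_at_top_dense)
      then have "\<forall>\<^sub>F n in sequentially. indicator {..<y n} u = (1::real)"
        by (rule eventually_mono) auto
      then have "(\<lambda>n. indicator {..<y n} u :: real) \<longlonglongrightarrow> 1" by (rule tendsto_eventually)
      moreover have "(\<lambda>n. exp (\<mu> * y n powr (r - 1) * u)) \<longlonglongrightarrow> exp (\<mu> * 0 * u)"
        by (intro tendsto_intros lim)
      ultimately show "(\<lambda>n. exp (\<mu> * y n powr (r - 1) * u) * indicator {..<y n} u) \<longlonglongrightarrow> 1"
        using tendsto_mult[of _ "exp (\<mu> * 0 * u)" _ _ 1] by simp
    qed
    fix n
    have "norm (exp (\<mu> * y n powr (r - 1) * u) * indicator {..<y n} u) \<le> exp (\<mu> * max u 0 powr r)" for u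
    proof (cases "u < y n")
      case u: True
      have "y n powr (r - 1) * u \<le> max u 0 powr r"
      proof (cases "u \<le> 0")
        case False
        then have "y n powr (r - 1) * u \<le> u powr (r - 1) * u"
          using u r by (intro mult_right_mono powr_mono2') auto
        also have "\<dots> = u powr r" using False by (simp add: powr_mult_base mult.commute)
        finally show ?thesis using False by simp
      qed (simp add: mult_nonneg_nonpos)
      then show ?thesis using u \<mu> by (simp add: mult.assoc mult_left_mono)
    qed auto
    then show "AE u in M. norm (exp (\<mu> * y n powr (r - 1) * u) * indicator {..<y n} u) \<le>
        exp (\<mu> * max u 0 powr r)" by simp
  qed auto
  then show ?thesis by (simp add: prob_space[simplified])
qed

subsection \<open>Large deviations of the walk\<close>

context prob_space
begin

text \<open>Either some step reaches \<open>y\<close>, which the union bound controls, or all steps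
  stay below \<open>y\<close>. In the second case every truncating indicator equals 1, and Markov's
  inequality for the product of the truncated exponentials applies.\<close>

lemma iid_sum_exp_bound:
  assumes indep: "indep_vars (\<lambda>_. borel) X UNIV" and distr: "\<And>i. distr M borel (X i) = D"
    and s: "0 \<le> s"
  shows "\<P>(\<omega> in M. y \<le> (\<Sum>i<n. X i \<omega>)) \<le>
    real n * measure D {y..} + exp (- s * y) * (\<integral>u. exp (s * u) * indicator {..<y} u \<partial>D) ^ n"
proof -
  have X [measurable]: "X i \<in> borel_measurable M" for i
    using indep by (auto simp: indep_vars_def2)
  define g where "g u = exp (s * u) * indicator {..<y} u" for u :: real
  have g [measurable]: "g \<in> borel_measurable borel" unfolding g_def by measurable
  have g_bound: "0 \<le> g u" "g u \<le> exp (s * y)" for u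
    unfolding g_def using s by (auto split: split_indicator intro!: mult_left_mono)
  have g_int: "integrable M (\<lambda>\<omega>. g (X i \<omega>))" for i
    by (rule integrable_const_bound[where B = "exp (s * y)"]) (use g_bound in \<open>auto simp: abs_of_nonneg\<close>)
  have indep_g: "indep_vars (\<lambda>_. borel) (\<lambda>i \<omega>. g (X i \<omega>)) {..<n}"
    by (rule indep_vars_compose2[OF indep_vars_subset[OF indep]]) auto
  note prod = indep_vars_lebesgue_integral[OF _ indep_g g_int] indep_vars_integrable[OF _ indep_g g_int]
  define E where "E = {\<omega>\<in>space M. y \<le> (\<Sum>i<n. X i \<omega>) \<and> (\<forall>i<n. X i \<omega> < y)}"
  have E [measurable]: "E \<in> events" unfolding E_def by measurable
  have "\<P>(\<omega> in M. y \<le> (\<Sum>i<n. X i \<omega>)) \<le> prob ((\<Union>i<n. {\<omega>\<in>space M. y \<le> X i \<omega>}) \<union> E)"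
    by (rule finite_measure_mono) (auto simp: E_def not_le)
  also have "\<dots> \<le> prob (\<Union>i<n. {\<omega>\<in>space M. y \<le> X i \<omega>}) + prob E"
    by (rule measure_Un_le) auto
  also have "prob (\<Union>i<n. {\<omega>\<in>space M. y \<le> X i \<omega>}) \<le> (\<Sum>i<n. prob {\<omega>\<in>space M. y \<le> X i \<omega>})"
    by (rule finite_measure_subadditive_finite) auto
  also have "\<dots> = (\<Sum>i<n. measure D {y..})"
  proof (rule sum.cong)
    fix i
    have "measure D {y..} = prob (X i -` {y..} \<inter> space M)"
      unfolding distr[of i, symmetric] by (rule measure_distr) auto
    also have "X i -` {y..} \<inter> space M = {\<omega>\<in>space M. y \<le> X i \<omega>}" by auto
    finally show "prob {\<omega>\<in>space M. y \<le> X i \<omega>} = measure D {y..}" ..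
  qed auto
  also have "prob E = (\<integral>\<omega>. indicator E \<omega> \<partial>M)" by simp
  also have "\<dots> \<le> (\<integral>\<omega>. exp (- s * y) * (\<Prod>i<n. g (X i \<omega>)) \<partial>M)"
  proof (rule integral_mono)
    fix \<omega>
    show "indicator E \<omega> \<le> exp (- s * y) * (\<Prod>i<n. g (X i \<omega>))"
    proof (cases "\<omega> \<in> E")
      case True
      then have "(\<Prod>i<n. g (X i \<omega>)) = exp (s * (\<Sum>i<n. X i \<omega>))"
        by (simp add: E_def g_def exp_sum sum_distrib_left)
      moreover have "s * y \<le> s * (\<Sum>i<n. X i \<omega>)" using True s by (auto simp: E_def intro!: mult_left_mono)
      ultimately show ?thesis using True by (simp add: exp_add[symmetric])
    qed (use g_bound in \<open>auto intro!: mult_nonneg_nonneg prod_nonneg\<close>)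
  qed (use prod in \<open>auto simp: less_top[symmetric]\<close>)
  also have "\<dots> = exp (- s * y) * (\<Prod>i<n. \<integral>u. g u \<partial>D)"
  proof -
    have "(\<integral>\<omega>. g (X i \<omega>) \<partial>M) = (\<integral>u. g u \<partial>D)" for i
      unfolding distr[of i, symmetric] by (rule integral_distr[symmetric]) auto
    then show ?thesis using prod by simp
  qed
  finally show ?thesis by (simp add: g_def)
qed

text \<open>Step 0 exceeds \<open>a + b\<close> and, independently, the other steps sum to at least
  \<open>- b\<close>. Markov's inequality for the absolute value of that sum gives the latter
  probability at least \<open>1 / 2\<close>; hence the factor 2 in the condition on
  \<open>b\<close>.\<close>

lemma iid_sum_one_big_jump:
  assumes indep: "indep_vars (\<lambda>_. borel) X UNIV" and distr: "\<And>i. distr M borel (X i) = D"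
    and n: "0 < n" and int: "integrable D (\<lambda>u. u)" and b: "0 < b" "2 * real n * (\<integral>u. \<bar>u\<bar> \<partial>D) \<le> b"
  shows "measure D {a + b..} / 2 \<le> \<P>(\<omega> in M. a \<le> (\<Sum>i<n. X i \<omega>))"
proof -
  have X [measurable]: "X i \<in> borel_measurable M" for i
    using indep by (auto simp: indep_vars_def2)
  have intX: "integrable M (X i)" and abs_X: "(\<integral>\<omega>. \<bar>X i \<omega>\<bar> \<partial>M) = (\<integral>u. \<bar>u\<bar> \<partial>D)" for i
  proof -
    have "integrable (distr M borel (X i)) (\<lambda>u. u)" using int by (simp add: distr)
    then show "integrable M (X i)" by (subst (asm) integrable_distr_eq) auto
    show "(\<integral>\<omega>. \<bar>X i \<omega>\<bar> \<partial>M) = (\<integral>u. \<bar>u\<bar> \<partial>D)"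
      unfolding distr[of i, symmetric] by (rule integral_distr[symmetric]) auto
  qed
  define S where "S \<omega> = (\<Sum>i\<in>{1..<n}. X i \<omega>)" for \<omega>
  have S [measurable]: "S \<in> borel_measurable M" unfolding S_def by measurable
  have indepS: "indep_var borel (X 0) borel S"
    unfolding S_def by (rule indep_vars_sum[OF _ _ indep_vars_subset[OF indep]]) auto
  have "(\<integral>\<omega>. \<bar>S \<omega>\<bar> \<partial>M) \<le> (\<integral>\<omega>. (\<Sum>i\<in>{1..<n}. \<bar>X i \<omega>\<bar>) \<partial>M)"
    unfolding S_def by (intro integral_mono integrable_abs Bochner_Integration.integrable_sum intX sum_abs)
  also have "\<dots> = (\<Sum>i\<in>{1..<n}. \<integral>u. \<bar>u\<bar> \<partial>D)"
    using intX by (simp add: abs_X)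
  also have "\<dots> \<le> real n * (\<integral>u. \<bar>u\<bar> \<partial>D)"
    by (simp add: mult_right_mono)
  finally have absS: "(\<integral>\<omega>. \<bar>S \<omega>\<bar> \<partial>M) \<le> b / 2" using b by simp
  have "\<P>(\<omega> in M. b \<le> \<bar>S \<omega>\<bar>) \<le> (\<integral>\<omega>. \<bar>S \<omega>\<bar> \<partial>M) / b"
    by (rule integral_Markov_inequality_measure[where A = "{}"])
      (use b intX in \<open>auto simp: S_def intro!: integrable_abs\<close>)
  also have "\<dots> \<le> 1 / 2" using absS b by (simp add: field_simps)
  finally have "\<P>(\<omega> in M. b \<le> \<bar>S \<omega>\<bar>) \<le> 1 / 2" .
  moreover have "prob (space M) \<le> prob ({\<omega>\<in>space M. b \<le> \<bar>S \<omega>\<bar>} \<union> (S -` {- b..} \<inter> space M))"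
    by (rule finite_measure_mono) auto
  moreover have "\<dots> \<le> \<P>(\<omega> in M. b \<le> \<bar>S \<omega>\<bar>) + prob (S -` {- b..} \<inter> space M)"
    by (rule measure_Un_le) auto
  ultimately have half: "1 / 2 \<le> prob (S -` {- b..} \<inter> space M)" by (simp add: prob_space)
  have "measure D {a + b..} = prob (X 0 -` {a + b..} \<inter> space M)"
    unfolding distr[of 0, symmetric] by (rule measure_distr) auto
  then have "measure D {a + b..} / 2 \<le>
      prob (X 0 -` {a + b..} \<inter> space M) * prob (S -` {- b..} \<inter> space M)"
    using mult_left_mono[OF half measure_nonneg[of D "{a + b..}"]] by simp
  also have "\<dots> = prob ((\<lambda>\<omega>. (X 0 \<omega>, S \<omega>)) -` ({a + b..} \<times> {- b..}) \<inter> space M)"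
    by (rule indep_varD[OF indepS, symmetric]) auto
  also have "\<dots> \<le> \<P>(\<omega> in M. a \<le> (\<Sum>i<n. X i \<omega>))"
  proof (rule finite_measure_mono)
    have "{..<n} = insert 0 {1..<n}" using n by auto
    then have "(\<Sum>i<n. X i \<omega>) = X 0 \<omega> + S \<omega>" for \<omega> by (simp add: S_def)
    then show "(\<lambda>\<omega>. (X 0 \<omega>, S \<omega>)) -` ({a + b..} \<times> {- b..}) \<inter> space M \<subseteq>
        {\<omega>\<in>space M. a \<le> (\<Sum>i<n. X i \<omega>)}" by auto
  qed measurable
  finally show ?thesis .
qed

lemma log_rate_iid_sum:
  assumes indep: "indep_vars (\<lambda>_. borel) X UNIV" and distr: "\<And>i. distr M borel (X i) = D"
    and int: "integrable D (\<lambda>u. u)" and tail: "stretched_tail D l r"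
    and l: "0 < l" and r: "0 < r" "r < 1" and x: "0 < x"
  shows "log_rate (\<lambda>n. \<P>(\<omega> in M. x * real n powr (1 / r) \<le> (\<Sum>i<n. X i \<omega>))) (- (l * x powr r))"
proof (rule log_rateI)
  have X [measurable]: "X i \<in> borel_measurable M" for i
    using indep by (auto simp: indep_vars_def2)
  have "prob_space (distr M borel (X 0))" by (rule prob_space_distr) simp
  then interpret D: real_distribution D
    by (intro real_distribution.intro real_distribution_axioms.intro) (auto simp: distr[of 0, symmetric])
  have powr_y: "(c * real n powr (1 / r)) powr r = c powr r * real n" if "0 < c" for c n
    using that r by (simp add: powr_mult powr_powr)
  have y_top: "filterlim (\<lambda>n. c * real n powr (1 / r)) at_top sequentially" if "0 < c" for c
    using that r by real_asymp
  have tail_ev: "\<forall>\<^sub>F n in sequentially.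
      exp (- (l + e) * (c powr r * real n)) \<le> measure D {c * real n powr (1 / r)..} \<and>
      measure D {c * real n powr (1 / r)..} \<le> exp (- (l - e) * (c powr r * real n))"
    if "0 < c" "0 < e" for c e
    using filterlim_iff[THEN iffD1, OF y_top[OF that(1)], rule_format,
      OF tail[unfolded stretched_tail_def, rule_format, OF that(2)]]
    unfolding powr_y[OF that(1)] .
  fix e :: real assume e: "0 < e"

  \<comment> \<open>A single \<open>d\<close> serves both as the error in the tail exponent and as
    the extra height \<open>d * n powr (1 / r)\<close> of the jump. As \<open>1 / r > 1\<close>,
    this height eventually exceeds \<open>2 * n * K\<close>.\<close>
  have "((\<lambda>d. (l + d) * (x + d) powr r) \<longlongrightarrow> (l + 0) * (x + 0) powr r) (at_right 0)"
    using x by (intro tendsto_intros) auto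
  then have "\<forall>\<^sub>F d in at_right 0. (l + d) * (x + d) powr r < l * x powr r + e / 2"
    by (rule order_tendstoD(2)) (use e in simp)
  then have "\<forall>\<^sub>F d in at_right 0. (l + d) * (x + d) powr r < l * x powr r + e / 2 \<and> 0 < d"
    by (intro eventually_conj eventually_at_right_less)
  then obtain d where d: "(l + d) * (x + d) powr r < l * x powr r + e / 2" "0 < d"
    by (auto dest!: eventually_happens simp: trivial_limit_at_right_real)
  define K where "K = (\<integral>u. \<bar>u\<bar> \<partial>D)"
  have "\<forall>\<^sub>F n in sequentially. 2 * real n * K \<le> d * real n powr (1 / r)"
    using d(2) r by real_asymp
  moreover have "\<forall>\<^sub>F n in sequentially. ln 2 \<le> real n * (e / 2)" using e by real_asymp
  moreover have "0 < x + d" using x d by simp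
  note tail_ev[OF this d(2)]
  ultimately show "\<forall>\<^sub>F n in sequentially. exp (real n * (- (l * x powr r) - e)) \<le>
      \<P>(\<omega> in M. x * real n powr (1 / r) \<le> (\<Sum>i<n. X i \<omega>))"
    using eventually_gt_at_top[of 0]
  proof eventually_elim
    case (elim n)
    have "real n * ((l + d) * (x + d) powr r) \<le> real n * (l * x powr r + e / 2)"
      using d by (intro mult_left_mono) auto
    then have "real n * (- (l * x powr r) - e) \<le> - (l + d) * ((x + d) powr r * real n) - ln 2"
      using elim(2) by (simp add: algebra_simps)
    then have "exp (real n * (- (l * x powr r) - e)) \<le> exp (- (l + d) * ((x + d) powr r * real n) - ln 2)"
      by (simp only: exp_le_cancel_iff)
    also have "\<dots> = exp (- (l + d) * ((x + d) powr r * real n)) / 2" by (simp add: exp_diff)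
    also have "\<dots> \<le> measure D {(x + d) * real n powr (1 / r)..} / 2"
      using elim by (intro divide_right_mono) auto
    also have "(x + d) * real n powr (1 / r) = x * real n powr (1 / r) + d * real n powr (1 / r)"
      by (simp add: algebra_simps)
    also have "measure D {\<dots>..} / 2 \<le> \<P>(\<omega> in M. x * real n powr (1 / r) \<le> (\<Sum>i<n. X i \<omega>))"
      by (rule iid_sum_one_big_jump[OF indep distr _ int]) (use elim d(2) in \<open>auto simp: K_def\<close>)
    finally show ?case .
  qed

  \<comment> \<open>The error is split into thirds: one for lowering \<open>l\<close> to \<mu>, one
    for \<open>\<psi> n ^ n\<close>, one for the prefactor \<open>n + 1\<close>. The tail estimate
    is used with the same \<open>h\<close>, so both terms of the bound carry the factor
    \<open>G\<close>.\<close>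
  define h where "h = min (l / 2) (e / (3 * x powr r))"
  have xr: "0 < x powr r" using x by simp
  have h: "0 < h" "h < l" "h * x powr r \<le> e / 3"
    using e l xr by (auto simp: h_def min_def field_simps)
  define \<mu> where "\<mu> = l - h"
  have \<mu>: "0 \<le> \<mu>" "\<mu> < l" using h by (auto simp: \<mu>_def)
  define y where "y n = x * real n powr (1 / r)" for n
  define \<psi> where "\<psi> n = (\<integral>u. exp (\<mu> * y n powr (r - 1) * u) * indicator {..<y n} u \<partial>D)" for n
  have "\<psi> \<longlonglongrightarrow> 1"
    unfolding \<psi>_def using y_top[OF x]
    by (intro D.truncated_mgf_tendsto[OF tail r \<mu>]) (simp add: y_def)
  then have "\<forall>\<^sub>F n in sequentially. \<psi> n < exp (e / 3)"
    by (rule order_tendstoD(2)) (use e in simp)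
  moreover have "\<forall>\<^sub>F n in sequentially. real n + 1 \<le> exp (real n * (e / 3))" using e by real_asymp
  ultimately show "\<forall>\<^sub>F n in sequentially. \<P>(\<omega> in M. x * real n powr (1 / r) \<le> (\<Sum>i<n. X i \<omega>)) \<le>
      exp (real n * (- (l * x powr r) + e))"
    using tail_ev[OF x h(1)] eventually_gt_at_top[of 0]
  proof eventually_elim
    case (elim n)
    define G where "G = exp (- \<mu> * (x powr r * real n))"
    have y: "0 < y n" using x elim by (simp add: y_def)
    have s: "\<mu> * y n powr (r - 1) * y n = \<mu> * (x powr r * real n)"
    proof -
      have "y n powr (r - 1) * y n = y n powr r"
        using powr_mult_base[of "y n" "r - 1"] y by (simp add: mult.commute)
      also have "\<dots> = x powr r * real n" unfolding y_def by (rule powr_y[OF x])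
      finally show ?thesis by (simp add: mult.assoc)
    qed
    have "0 \<le> \<psi> n" unfolding \<psi>_def by (intro integral_nonneg_AE) auto
    then have "\<psi> n ^ n \<le> exp (e / 3) ^ n" using elim by (intro power_mono) auto
    then have \<psi>: "\<psi> n ^ n \<le> exp (real n * (e / 3))" by (simp only: exp_of_nat_mult)
    have "\<P>(\<omega> in M. y n \<le> (\<Sum>i<n. X i \<omega>)) \<le> real n * measure D {y n..} +
        exp (- (\<mu> * y n powr (r - 1)) * y n) * \<psi> n ^ n"
      unfolding \<psi>_def by (rule iid_sum_exp_bound[OF indep distr]) (use \<mu> in auto)
    also have "exp (- (\<mu> * y n powr (r - 1)) * y n) = G"
      unfolding G_def mult_minus_left s ..
    also have "real n * measure D {y n..} + G * \<psi> n ^ n \<le> real n * G + G * exp (real n * (e / 3))"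
      using elim \<psi> by (intro add_mono mult_left_mono) (auto simp: y_def G_def \<mu>_def)
    also have "\<dots> = G * (real n + exp (real n * (e / 3)))" by (simp add: algebra_simps)
    also have "\<dots> \<le> G * (exp (real n * (e / 3)) * exp (real n * (e / 3)))"
    proof (rule mult_left_mono)
      define w where "w = exp (real n * (e / 3))"
      have "real n + 1 \<le> w" "1 \<le> w" using elim e by (auto simp: w_def)
      then have "real n + w \<le> (real n + 1) * w"
        using mult_left_mono[of 1 w "real n"] by (simp add: algebra_simps)
      also have "\<dots> \<le> w * w" using \<open>real n + 1 \<le> w\<close> \<open>1 \<le> w\<close> by (intro mult_right_mono) auto
      finally show "real n + exp (real n * (e / 3)) \<le> exp (real n * (e / 3)) * exp (real n * (e / 3))"
        by (simp add: w_def)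
    qed (simp add: G_def)
    also have "\<dots> = exp (real n * (- (l * x powr r) + (h * x powr r + e / 3 + e / 3)))"
      by (simp add: G_def exp_add[symmetric] \<mu>_def algebra_simps)
    also have "\<dots> \<le> exp (real n * (- (l * x powr r) + e))"
      unfolding exp_le_cancel_iff using h by (intro mult_left_mono) auto
    finally show ?case by (simp add: y_def)
  qed
qed

end

subsection \<open>The branching process\<close>

context prob_space
begin

text \<open>Conditioning on the integer-valued \<open>A\<close> by summation over its values;
  \<open>c z\<close> acts as the conditional expectation of \<open>W z\<close> given
  \<open>A = z\<close>. Nonnegative integrals allow the countable sum to be interchanged
  freely.\<close>

lemma expectation_random_index:
  fixes A :: "'a \<Rightarrow> nat" and W :: "nat \<Rightarrow> 'a \<Rightarrow> real"
  assumes A [measurable]: "A \<in> measurable M (count_space UNIV)"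
    and W [measurable]: "\<And>z. W z \<in> borel_measurable M"
    and W_nonneg: "\<And>z \<omega>. 0 \<le> W z \<omega>" and W_le: "\<And>z \<omega>. W z \<omega> \<le> 1"
    and c: "\<And>z. expectation (\<lambda>\<omega>. indicator {z} (A \<omega>) * W z \<omega>) = \<P>(\<omega> in M. A \<omega> = z) * c z"
    and c_nonneg: "\<And>z. 0 \<le> c z"
  shows "expectation (\<lambda>\<omega>. W (A \<omega>) \<omega>) = expectation (\<lambda>\<omega>. c (A \<omega>))"
proof -
  have ind_meas [measurable]: "(\<lambda>\<omega>. indicator {z} (A \<omega>) :: real) \<in> borel_measurable M" for z
    by (rule measurable_compose[OF A]) simp
  have *: "(\<integral>\<^sup>+ \<omega>. ennreal (V (A \<omega>) \<omega>) \<partial>M) =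
      (\<Sum>z. \<integral>\<^sup>+ \<omega>. ennreal (indicator {z} (A \<omega>) * V z \<omega>) \<partial>M)"
    if V: "\<And>z. V z \<in> borel_measurable M" for V :: "nat \<Rightarrow> 'a \<Rightarrow> real"
  proof -
    note V [measurable]
    have "ennreal (V (A \<omega>) \<omega>) = (\<Sum>z. ennreal (indicator {z} (A \<omega>) * V z \<omega>))" for \<omega>
      by (subst suminf_finite[of "{A \<omega>}"]) auto
    then have "(\<integral>\<^sup>+ \<omega>. ennreal (V (A \<omega>) \<omega>) \<partial>M) =
        (\<integral>\<^sup>+ \<omega>. (\<Sum>z. ennreal (indicator {z} (A \<omega>) * V z \<omega>)) \<partial>M)" by simp
    also have "\<dots> = (\<Sum>z. \<integral>\<^sup>+ \<omega>. ennreal (indicator {z} (A \<omega>) * V z \<omega>) \<partial>M)"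
      by (rule nn_integral_suminf) measurable
    finally show ?thesis .
  qed
  have "(\<integral>\<^sup>+ \<omega>. ennreal (indicator {z} (A \<omega>) * W z \<omega>) \<partial>M) =
      (\<integral>\<^sup>+ \<omega>. ennreal (indicator {z} (A \<omega>) * c z) \<partial>M)" for z
  proof -
    have ind: "expectation (\<lambda>\<omega>. indicator {z} (A \<omega>)) = \<P>(\<omega> in M. A \<omega> = z)"
    proof -
      have "expectation (\<lambda>\<omega>. indicator {z} (A \<omega>)) =
          expectation (indicator {\<omega>\<in>space M. A \<omega> = z} :: 'a \<Rightarrow> real)"
        by (rule Bochner_Integration.integral_cong) (auto split: split_indicator)
      then show ?thesis by simp
    qed
    have "(\<integral>\<^sup>+ \<omega>. ennreal (indicator {z} (A \<omega>) * W z \<omega>) \<partial>M) =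
        ennreal (expectation (\<lambda>\<omega>. indicator {z} (A \<omega>) * W z \<omega>))"
    proof (rule nn_integral_eq_integral)
      show "integrable M (\<lambda>\<omega>. indicator {z} (A \<omega>) * W z \<omega>)"
        by (rule integrable_const_bound[where B = 1])
          (use W_nonneg W_le in \<open>auto simp: abs_of_nonneg split: split_indicator\<close>)
    qed (use W_nonneg in auto)
    also have "\<dots> = ennreal (expectation (\<lambda>\<omega>. indicator {z} (A \<omega>) * c z))"
      by (simp add: c ind)
    also have "\<dots> = (\<integral>\<^sup>+ \<omega>. ennreal (indicator {z} (A \<omega>) * c z) \<partial>M)"
    proof (rule nn_integral_eq_integral[symmetric])
      show "integrable M (\<lambda>\<omega>. indicator {z} (A \<omega>) * c z)"
        by (rule integrable_const_bound[where B = "c z"])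
          (use c_nonneg in \<open>auto simp: abs_of_nonneg split: split_indicator\<close>)
    qed (use c_nonneg in auto)
    finally show ?thesis .
  qed
  then have "(\<integral>\<^sup>+ \<omega>. ennreal (W (A \<omega>) \<omega>) \<partial>M) = (\<integral>\<^sup>+ \<omega>. ennreal (c (A \<omega>)) \<partial>M)"
    by (subst (1 2) *) auto
  moreover have "(\<lambda>\<omega>. W (A \<omega>) \<omega>) \<in> borel_measurable M"
    by (rule measurable_compose_countable) auto
  ultimately show ?thesis
    using W_nonneg c_nonneg by (simp add: integral_eq_nn_integral)
qed

end

text \<open>As a function of the offspring array alone, generation \<open>n\<close> visibly depends
  only on the rows below \<open>n\<close>; this makes it independent of row
  \<open>n\<close>.\<close>

fun gw_population :: "nat \<Rightarrow> (nat \<times> nat \<Rightarrow> nat) \<Rightarrow> nat" where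
  "gw_population 0 x = 1"
| "gw_population (Suc n) x = (\<Sum>i<gw_population n x. x (n, i))"

lemma gw_population_measurable:
  "{..<n} \<times> UNIV \<subseteq> K \<Longrightarrow>
    gw_population n \<in> measurable (PiM K (\<lambda>_. count_space UNIV)) (count_space UNIV)"
proof (induction n)
  case 0
  have "gw_population 0 = (\<lambda>_. 1)" by auto
  then show ?case by simp
next
  case (Suc n)
  have "(\<lambda>x. \<Sum>i<j. x (n, i)) \<in> measurable (PiM K (\<lambda>_. count_space UNIV)) (count_space (UNIV :: nat set))" for j
  proof -
    have "(\<lambda>x. x (n, i)) \<in> borel_measurable (PiM K (\<lambda>_. count_space UNIV :: nat measure))" for i
    proof -
      have "(\<lambda>x. x (n, i)) \<in> measurable (PiM K (\<lambda>_. count_space UNIV)) (count_space (UNIV :: nat set))"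
        by (rule measurable_component_singleton) (use Suc.prems in auto)
      then show ?thesis by (rule measurable_compose) simp
    qed
    then have "(\<lambda>x. \<Sum>i<j. x (n, i)) \<in> borel_measurable (PiM K (\<lambda>_. count_space UNIV :: nat measure))"
      by (intro borel_measurable_sum)
    then show ?thesis
      unfolding measurable_cong_sets[OF refl sets_borel_eq_count_space] .
  qed
  moreover have "{..<n} \<times> UNIV \<subseteq> K" using Suc.prems by auto
  note Suc.IH[OF this]
  ultimately have "(\<lambda>x. \<Sum>i<gw_population n x. x (n, i)) \<in>
      measurable (PiM K (\<lambda>_. count_space UNIV)) (count_space UNIV)"
    by (rule measurable_compose_countable)
  moreover have "gw_population (Suc n) = (\<lambda>x. \<Sum>i<gw_population n x. x (n, i))" by auto
  ultimately show ?case by simp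
qed

lemma gw_population_restrict:
  "{..<n} \<times> UNIV \<subseteq> K \<Longrightarrow> gw_population n (restrict x K) = gw_population n x"
proof (induction n)
  case (Suc n)
  then have "{..<n} \<times> UNIV \<subseteq> K" and "(n, i) \<in> K" for i by auto
  then show ?case using Suc.IH by simp
qed simp

context prob_space
begin

lemma galton_watson_measurable:
  assumes "galton_watson M p Z"
  shows "Z n \<in> measurable M (count_space UNIV)"
proof -
  obtain \<xi> where \<xi>: "indep_vars (\<lambda>_. count_space UNIV) (\<lambda>(n, i). \<xi> n i) UNIV"
    "\<And>\<omega>. \<omega> \<in> space M \<Longrightarrow> Z 0 \<omega> = 1 \<and> (\<forall>n. Z (Suc n) \<omega> = (\<Sum>i<Z n \<omega>. \<xi> n i \<omega>))"
    using assms unfolding galton_watson_def by blast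
  have "(\<lambda>\<omega>. \<lambda>a\<in>UNIV. (case a of (n, i) \<Rightarrow> \<xi> n i) \<omega>) \<in> measurable M (PiM UNIV (\<lambda>_. count_space UNIV))"
    by (intro measurable_restrict) (use \<xi>(1) in \<open>auto simp: indep_vars_def2\<close>)
  then have "(\<lambda>\<omega>. gw_population n (\<lambda>a. (case a of (n, i) \<Rightarrow> \<xi> n i) \<omega>)) \<in> measurable M (count_space UNIV)"
    unfolding restrict_UNIV by (rule measurable_compose) (simp add: gw_population_measurable)
  moreover have "Z n \<omega> = gw_population n (\<lambda>a. (case a of (n, i) \<Rightarrow> \<xi> n i) \<omega>)" if "\<omega> \<in> space M" for \<omega>
    by (induction n) (use \<xi>(2)[OF that] in auto)
  ultimately show ?thesis by (simp cong: measurable_cong)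
qed

text \<open>The recursion splits off the last generation: given \<open>Z n = z\<close>, the
  expectation is \<open>pgf p u ^ z\<close>, so the induction hypothesis is applied at
  \<open>pgf p u\<close> and \<open>u\<close> must stay arbitrary.\<close>

lemma expectation_power_galton_watson:
  assumes gw: "galton_watson M p Z" and u: "0 \<le> u" "u \<le> 1"
  shows "expectation (\<lambda>\<omega>. u ^ Z n \<omega>) = (pgf p ^^ n) u"
  using u
proof (induction n arbitrary: u)
  case 0
  have "expectation (\<lambda>\<omega>. u ^ Z 0 \<omega>) = expectation (\<lambda>_. u)"
    by (rule Bochner_Integration.integral_cong) (use gw in \<open>auto simp: galton_watson_def\<close>)
  then show ?case by (simp add: prob_space)
next
  case (Suc n)
  note [measurable] = galton_watson_measurable[OF gw]
  obtain \<xi> where indep: "indep_vars (\<lambda>_. count_space UNIV) (\<lambda>(n, i). \<xi> n i) UNIV"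
    and distr: "\<And>n i. distr M (count_space UNIV) (\<xi> n i) = measure_pmf p"
    and Z: "\<And>\<omega>. \<omega> \<in> space M \<Longrightarrow> Z 0 \<omega> = 1 \<and> (\<forall>n. Z (Suc n) \<omega> = (\<Sum>i<Z n \<omega>. \<xi> n i \<omega>))"
    using gw unfolding galton_watson_def by blast
  have \<xi> [measurable]: "\<xi> n i \<in> measurable M (count_space UNIV)" for n i
    using indep by (auto simp: indep_vars_def2)
  define x where "x \<omega> a = (case a of (n, i) \<Rightarrow> \<xi> n i) \<omega>" for \<omega> a
  have Z_eq: "Z n \<omega> = gw_population n (x \<omega>)" if "\<omega> \<in> space M" for \<omega> n
    by (induction n) (use Z[OF that] in \<open>auto simp: x_def\<close>)
  \<comment> \<open>\<open>K True\<close> is the past, the rows that determine \<open>Z n\<close>;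
    \<open>K False\<close> is the row of the next reproduction.\<close>
  define K :: "bool \<Rightarrow> (nat \<times> nat) set" where "K b = (if b then {..<n} \<times> UNIV else {n} \<times> UNIV)" for b
  have indepK: "indep_vars (\<lambda>b. PiM (K b) (\<lambda>_. count_space UNIV)) (\<lambda>b \<omega>. restrict (x \<omega>) (K b)) UNIV"
    unfolding x_def by (rule indep_vars_restrict[OF indep]) (auto simp: disjoint_family_on_def K_def)
  define W where "W z \<omega> = (\<Prod>i<z. u ^ \<xi> n i \<omega>)" for z \<omega>
  have W [measurable]: "W z \<in> borel_measurable M" for z
    unfolding W_def by measurable
  have \<xi>_int: "expectation (\<lambda>\<omega>. u ^ \<xi> n i \<omega>) = pgf p u" "integrable M (\<lambda>\<omega>. u ^ \<xi> n i \<omega>)" for i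
  proof -
    have "expectation (\<lambda>\<omega>. u ^ \<xi> n i \<omega>) = (\<integral>k. u ^ k \<partial>distr M (count_space UNIV) (\<xi> n i))"
      by (rule integral_distr[symmetric]) auto
    then show "expectation (\<lambda>\<omega>. u ^ \<xi> n i \<omega>) = pgf p u" by (simp add: distr pgf_def)
    show "integrable M (\<lambda>\<omega>. u ^ \<xi> n i \<omega>)"
      by (rule integrable_const_bound[where B = 1]) (use Suc.prems in \<open>auto simp: power_le_one\<close>)
  qed
  have EW: "expectation (W z) = pgf p u ^ z" for z
  proof -
    have "indep_vars (\<lambda>i. PiM {(n, i)} (\<lambda>_. count_space UNIV)) (\<lambda>i \<omega>. restrict (x \<omega>) {(n, i)}) {..<z}"
      unfolding x_def by (rule indep_vars_restrict[OF indep]) (auto simp: disjoint_family_on_def)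
    then have "indep_vars (\<lambda>_. borel) (\<lambda>i \<omega>. u ^ (restrict (x \<omega>) {(n, i)} (n, i))) {..<z}"
      by (rule indep_vars_compose2[where Y = "\<lambda>i f. u ^ f (n, i)"]) measurable
    then have "indep_vars (\<lambda>_. borel) (\<lambda>i \<omega>. u ^ \<xi> n i \<omega>) {..<z}"
      by (simp add: x_def)
    then show ?thesis
      unfolding W_def by (subst indep_vars_lebesgue_integral) (simp_all add: \<xi>_int)
  qed
  have "expectation (\<lambda>\<omega>. u ^ Z (Suc n) \<omega>) = expectation (\<lambda>\<omega>. W (Z n \<omega>) \<omega>)"
    by (rule Bochner_Integration.integral_cong) (auto simp: Z W_def power_sum)
  also have "\<dots> = expectation (\<lambda>\<omega>. pgf p u ^ Z n \<omega>)"
  proof (rule expectation_random_index)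
    fix z
    show "0 \<le> W z \<omega>" "W z \<omega> \<le> 1" for \<omega>
      unfolding W_def using Suc.prems by (auto intro!: prod_nonneg prod_le_1 power_le_one)
    \<comment> \<open>Indexing the two functionals by \<open>bool\<close> turns the product of a
      function of the past and a function of row \<open>n\<close> into the product formula for an
      independent family.\<close>
    define f where "f b = (if b then (\<lambda>x. indicator {z} (gw_population n x)) else (\<lambda>x. \<Prod>i<z. u ^ x (n, i)))"
      for b :: bool
    have f_meas: "f b \<in> borel_measurable (PiM (K b) (\<lambda>_. count_space UNIV))" for b
    proof (cases b)
      case True
      have "gw_population n \<in> measurable (PiM (K True) (\<lambda>_. count_space UNIV)) (count_space UNIV)"
        by (rule gw_population_measurable) (simp add: K_def)
      then have "(\<lambda>x. indicator {z} (gw_population n x) :: real) \<in>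
          borel_measurable (PiM (K True) (\<lambda>_. count_space UNIV))"
        by (rule measurable_compose) simp
      then show ?thesis unfolding f_def using True by simp
    next
      case False
      have "(\<lambda>x. x (n, i)) \<in> measurable (PiM (K False) (\<lambda>_. count_space UNIV)) (count_space (UNIV :: nat set))" for i
        by (rule measurable_component_singleton) (simp add: K_def)
      then have "(\<lambda>x. u ^ x (n, i)) \<in> borel_measurable (PiM (K False) (\<lambda>_. count_space UNIV))" for i
        by (rule measurable_compose) simp
      then show ?thesis unfolding f_def using False by simp
    qed
    have f_eq: "f True (restrict (x \<omega>) (K True)) = indicator {z} (Z n \<omega>)" if "\<omega> \<in> space M" for \<omega>
      using that by (simp add: f_def gw_population_restrict K_def Z_eq)
    have f_eq': "f False (restrict (x \<omega>) (K False)) = W z \<omega>" for \<omega>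
      by (simp add: f_def W_def K_def x_def)
    have "indep_vars (\<lambda>_. borel) (\<lambda>b \<omega>. f b (restrict (x \<omega>) (K b))) UNIV"
      by (rule indep_vars_compose2[OF indepK]) (rule f_meas)
    moreover have "integrable M (\<lambda>\<omega>. f b (restrict (x \<omega>) (K b)))" for b
    proof (rule integrable_const_bound[where B = 1])
      show "(\<lambda>\<omega>. f b (restrict (x \<omega>) (K b))) \<in> borel_measurable M"
        using calculation by (auto simp: indep_vars_def2)
      show "AE \<omega> in M. norm (f b (restrict (x \<omega>) (K b))) \<le> 1"
      proof (intro AE_I2)
        fix \<omega>
        have "0 \<le> W z \<omega>" "W z \<omega> \<le> 1"
          unfolding W_def using Suc.prems by (auto intro!: prod_nonneg prod_le_1 power_le_one)
        then show "norm (f b (restrict (x \<omega>) (K b))) \<le> 1"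
          using f_eq'[of \<omega>] by (cases b) (auto simp: f_def split: split_indicator)
      qed
    qed
    ultimately have "expectation (\<lambda>\<omega>. \<Prod>b\<in>UNIV. f b (restrict (x \<omega>) (K b))) =
        (\<Prod>b\<in>UNIV. expectation (\<lambda>\<omega>. f b (restrict (x \<omega>) (K b))))"
      by (intro indep_vars_lebesgue_integral) auto
    then have "expectation (\<lambda>\<omega>. f True (restrict (x \<omega>) (K True)) * W z \<omega>) =
        expectation (\<lambda>\<omega>. f True (restrict (x \<omega>) (K True))) * expectation (W z)"
      by (simp add: UNIV_bool f_eq' mult.commute)
    moreover have "expectation (\<lambda>\<omega>. f True (restrict (x \<omega>) (K True)) * W z \<omega>) =
        expectation (\<lambda>\<omega>. indicator {z} (Z n \<omega>) * W z \<omega>)"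
      by (rule Bochner_Integration.integral_cong) (simp_all add: f_eq)
    moreover have "expectation (\<lambda>\<omega>. f True (restrict (x \<omega>) (K True))) =
        expectation (indicator {\<omega>\<in>space M. Z n \<omega> = z})"
      by (rule Bochner_Integration.integral_cong) (auto simp: f_eq split: split_indicator)
    ultimately show "expectation (\<lambda>\<omega>. indicator {z} (Z n \<omega>) * W z \<omega>) =
        \<P>(\<omega> in M. Z n \<omega> = z) * pgf p u ^ z"
      by (simp add: EW)
  qed (use Suc.prems in \<open>auto intro!: zero_le_power pgf_nonneg\<close>)
  also have "\<dots> = (pgf p ^^ n) (pgf p u)"
    using Suc by (simp add: pgf_nonneg pgf_le_1)
  finally show ?case by (simp add: funpow_swap1)
qed

end

subsection \<open>The maximum of the walks\<close>

context prob_space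
begin

context
  fixes Y :: "nat \<Rightarrow> nat \<Rightarrow> 'a \<Rightarrow> real" and N :: "'b measure" and X :: "'b \<Rightarrow> real"
  assumes iid: "iid_copies M Y N X"
begin

lemma step_measurable [measurable]: "Y j i \<in> borel_measurable M"
  using iid by (auto simp: iid_copies_def indep_vars_def2)

lemma walk_measurable [measurable]: "walk Y j n \<in> borel_measurable M"
  unfolding walk_def by measurable

lemma indep_steps: "indep_vars (\<lambda>_. borel) (Y j) UNIV"
proof -
  have "indep_vars (\<lambda>_. borel) (\<lambda>(j, i). Y j i) UNIV" using iid by (simp add: iid_copies_def)
  then have "indep_vars (\<lambda>i. PiM {(j, i)} (\<lambda>_. borel))
      (\<lambda>i \<omega>. \<lambda>a\<in>{(j, i)}. (case a of (j, i) \<Rightarrow> Y j i) \<omega>) UNIV"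
    by (rule indep_vars_restrict) (auto simp: disjoint_family_on_def)
  then have "indep_vars (\<lambda>_. borel)
      (\<lambda>i \<omega>. (\<lambda>a\<in>{(j, i)}. (case a of (j, i) \<Rightarrow> Y j i) \<omega>) (j, i)) UNIV"
    by (rule indep_vars_compose2[where Y = "\<lambda>i f. f (j, i)"]) measurable
  then show ?thesis by simp
qed

lemma indep_walks: "indep_vars (\<lambda>_. borel) (\<lambda>j. walk Y j n) UNIV"
proof -
  define K :: "nat \<Rightarrow> (nat \<times> nat) set" where "K j = {j} \<times> UNIV" for j
  have "indep_vars (\<lambda>_. borel) (\<lambda>(j, i). Y j i) UNIV" using iid by (simp add: iid_copies_def)
  then have "indep_vars (\<lambda>j. PiM (K j) (\<lambda>_. borel))
      (\<lambda>j \<omega>. \<lambda>a\<in>K j. (case a of (j, i) \<Rightarrow> Y j i) \<omega>) UNIV"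
    by (rule indep_vars_restrict) (auto simp: disjoint_family_on_def K_def)
  then have "indep_vars (\<lambda>_. borel)
      (\<lambda>j \<omega>. \<Sum>i<n. (\<lambda>a\<in>K j. (case a of (j, i) \<Rightarrow> Y j i) \<omega>) (j, i)) UNIV"
  proof (rule indep_vars_compose2[where Y = "\<lambda>j f. \<Sum>i<n. f (j, i)"])
    fix j
    have "(\<lambda>f. f (j, i)) \<in> borel_measurable (PiM (K j) (\<lambda>_. borel :: real measure))" for i
      by (rule measurable_component_singleton) (simp add: K_def)
    then show "(\<lambda>f. \<Sum>i<n. f (j, i)) \<in> borel_measurable (PiM (K j) (\<lambda>_. borel :: real measure))"
      by (intro borel_measurable_sum)
  qed
  then show ?thesis by (simp add: K_def walk_def[abs_def])
qed

text \<open>The law of a sum is determined by the joint law of its terms, so the product measure,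
  which is the same for every \<open>j\<close>, is what makes all walks equidistributed.\<close>

lemma distr_steps: "distr M (PiM UNIV (\<lambda>_. borel)) (\<lambda>\<omega> i. Y j i \<omega>) = PiM UNIV (\<lambda>_. distr N borel X)"
proof -
  have "distr M (PiM UNIV (\<lambda>_. borel)) (\<lambda>\<omega>. \<lambda>i\<in>UNIV. Y j i \<omega>) = PiM UNIV (\<lambda>i. distr M borel (Y j i))"
    using indep_steps by (subst (asm) indep_vars_iff_distr_eq_PiM) auto
  then show ?thesis using iid by (simp add: iid_copies_def restrict_UNIV)
qed

lemma distr_walk: "distr M borel (walk Y j n) = distr M borel (walk Y 0 n)"
proof -
  have "distr M borel (walk Y j n) =
      distr (PiM UNIV (\<lambda>_. distr N borel X)) borel (\<lambda>x. \<Sum>i<n. x i)" for j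
    unfolding distr_steps[of j, symmetric]
    by (subst distr_distr) (auto simp: comp_def walk_def[abs_def] intro!: measurable_PiM_single')
  then show ?thesis by metis
qed

lemma prob_all_walks_fixed:
  assumes B [measurable]: "B \<in> sets borel"
  shows "\<P>(\<omega> in M. \<forall>j<z. walk Y j n \<omega> \<in> B) = \<P>(\<omega> in M. walk Y 0 n \<omega> \<in> B) ^ z"
proof (cases "z = 0")
  case False
  have same: "prob (walk Y j n -` B \<inter> space M) = \<P>(\<omega> in M. walk Y 0 n \<omega> \<in> B)" for j
  proof -
    have "prob (walk Y j n -` B \<inter> space M) = measure (distr M borel (walk Y j n)) B"
      by (rule measure_distr[symmetric]) auto
    also have "\<dots> = measure (distr M borel (walk Y 0 n)) B" by (simp only: distr_walk[of j n])
    also have "\<dots> = prob (walk Y 0 n -` B \<inter> space M)" by (rule measure_distr) auto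
    also have "walk Y 0 n -` B \<inter> space M = {\<omega>\<in>space M. walk Y 0 n \<omega> \<in> B}" by auto
    finally show ?thesis .
  qed
  have "{\<omega>\<in>space M. \<forall>j<z. walk Y j n \<omega> \<in> B} = (\<Inter>j\<in>{..<z}. walk Y j n -` B \<inter> space M)"
    using False by auto
  also have "prob \<dots> = (\<Prod>j\<in>{..<z}. prob (walk Y j n -` B \<inter> space M))"
    by (rule indep_varsD[OF indep_walks]) (use False in auto)
  finally show ?thesis by (simp add: same)
qed (simp add: prob_space)

context
  fixes p :: "nat pmf" and Z :: "nat \<Rightarrow> 'a \<Rightarrow> nat"
  assumes gw: "galton_watson M p Z" and indep_ZY: "indep_families M Z Y"
begin

lemma prob_all_walks:
  assumes B [measurable]: "B \<in> sets borel"
  shows "\<P>(\<omega> in M. \<forall>j<Z n \<omega>. walk Y j n \<omega> \<in> B) = (pgf p ^^ n) \<P>(\<omega> in M. walk Y 0 n \<omega> \<in> B)"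
proof -
  define F where "F = \<P>(\<omega> in M. walk Y 0 n \<omega> \<in> B)"
  have F: "0 \<le> F" "F \<le> 1" by (auto simp: F_def)
  note [measurable] = galton_watson_measurable[OF gw]
  define E where "E z = {\<omega>\<in>space M. \<forall>j<z. walk Y j n \<omega> \<in> B}" for z
  have E [measurable]: "E z \<in> events" for z unfolding E_def by measurable
  have indep: "prob ({\<omega>\<in>space M. Z n \<omega> = z} \<inter> E z) = \<P>(\<omega> in M. Z n \<omega> = z) * prob (E z)" for z
  proof (rule indep_setD[OF indep_ZY[unfolded indep_families_def]])
    have "{f \<in> space (PiM UNIV (\<lambda>_. count_space UNIV)). f n = z} \<in>
        sets (PiM UNIV (\<lambda>_::nat. count_space (UNIV :: nat set)))"
      by measurable
    then show "{\<omega>\<in>space M. Z n \<omega> = z} \<in> {(\<lambda>\<omega> n. Z n \<omega>) -` A \<inter> space M |A.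
        A \<in> sets (Pi\<^sub>M UNIV (\<lambda>_. count_space UNIV))}"
      by (auto intro!: exI[of _ "{f \<in> space (PiM UNIV (\<lambda>_. count_space UNIV)). f n = z}"]
        simp: space_PiM)
    have "{f \<in> space (PiM UNIV (\<lambda>_. borel)). \<forall>j<z. (\<Sum>i<n. f (j, i)) \<in> B} \<in>
        sets (PiM UNIV (\<lambda>_::nat \<times> nat. borel :: real measure))"
      by measurable
    then show "E z \<in> {(\<lambda>\<omega> (j, k). Y j k \<omega>) -` B \<inter> space M |B. B \<in> sets (Pi\<^sub>M UNIV (\<lambda>_. borel))}"
      by (auto intro!: exI[of _ "{f \<in> space (PiM UNIV (\<lambda>_. borel)). \<forall>j<z. (\<Sum>i<n. f (j, i)) \<in> B}"]
        simp: space_PiM E_def walk_def)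
  qed
  have "\<P>(\<omega> in M. \<forall>j<Z n \<omega>. walk Y j n \<omega> \<in> B) =
      expectation (indicator {\<omega>\<in>space M. \<forall>j<Z n \<omega>. walk Y j n \<omega> \<in> B} :: 'a \<Rightarrow> real)"
  proof -
    have "Measurable.pred M (\<lambda>\<omega>. \<forall>j<Z n \<omega>. walk Y j n \<omega> \<in> B)"
      by (rule measurable_compose_countable[where f = "\<lambda>z \<omega>. \<forall>j<z. walk Y j n \<omega> \<in> B"]) measurable
    then have "{\<omega>\<in>space M. \<forall>j<Z n \<omega>. walk Y j n \<omega> \<in> B} \<in> events" by simp
    then show ?thesis by simp
  qed
  also have "\<dots> = expectation (\<lambda>\<omega>. indicator (E (Z n \<omega>)) \<omega>)"
    by (rule Bochner_Integration.integral_cong) (auto simp: E_def split: split_indicator)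
  also have "\<dots> = expectation (\<lambda>\<omega>. F ^ Z n \<omega>)"
  proof (rule expectation_random_index)
    fix z
    have "expectation (\<lambda>\<omega>. indicator {z} (Z n \<omega>) * indicator (E z) \<omega>) =
        expectation (indicator ({\<omega>\<in>space M. Z n \<omega> = z} \<inter> E z) :: 'a \<Rightarrow> real)"
      by (rule Bochner_Integration.integral_cong) (auto split: split_indicator)
    also have "\<dots> = \<P>(\<omega> in M. Z n \<omega> = z) * prob (E z)" by (simp add: indep)
    also have "prob (E z) = F ^ z" unfolding E_def F_def by (rule prob_all_walks_fixed[OF B])
    finally show "expectation (\<lambda>\<omega>. indicator {z} (Z n \<omega>) * indicator (E z) \<omega>) =
        \<P>(\<omega> in M. Z n \<omega> = z) * F ^ z" .
  qed (use F in \<open>auto split: split_indicator\<close>)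
  also have "\<dots> = (pgf p ^^ n) F"
    by (rule expectation_power_galton_watson[OF gw F])
  finally show ?thesis by (simp add: F_def)
qed

lemma max_walk_measurable: "max_walk Z Y n \<in> borel_measurable M"
proof -
  have "(\<lambda>\<omega>. Max ((\<lambda>j. walk Y j n \<omega>) ` {..<Z n \<omega>})) \<in> borel_measurable M"
    by (rule measurable_compose_countable[OF _ galton_watson_measurable[OF gw]])
      (intro borel_measurable_Max, auto)
  then show ?thesis by (simp add: max_walk_def[abs_def])
qed

context
  assumes pmf_0: "pmf p 0 = 0"
begin

text \<open>Since \<open>0 ^ 0 = 1\<close>, the variable \<open>0 ^ Z n\<close> is the indicator of
  extinction, and 0 is a fixed point of \<open>pgf p\<close>. This disposes of the maximum over an
  empty set.\<close>

lemma AE_population_pos: "AE \<omega> in M. 0 < Z n \<omega>"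
proof -
  note [measurable] = galton_watson_measurable[OF gw]
  have "pgf p 0 = 0"
  proof -
    have "pgf p 0 = measure_pmf.expectation p (indicator {0})"
      unfolding pgf_def by (intro Bochner_Integration.integral_cong refl) (simp add: indicator_def power_0_left)
    then show ?thesis using pmf_0 by (simp add: measure_pmf_single)
  qed
  then have "(pgf p ^^ n) 0 = 0" by (induction n) auto
  moreover have "expectation (\<lambda>\<omega>. 0 ^ Z n \<omega>) = (pgf p ^^ n) 0"
    by (rule expectation_power_galton_watson[OF gw]) auto
  moreover have "expectation (\<lambda>\<omega>. 0 ^ Z n \<omega>) =
      expectation (indicator {\<omega>\<in>space M. Z n \<omega> = 0} :: 'a \<Rightarrow> real)"
    by (rule Bochner_Integration.integral_cong) (auto simp: power_0_left split: split_indicator)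
  ultimately have "\<P>(\<omega> in M. Z n \<omega> = 0) = 0" by simp
  then show ?thesis by (subst (asm) prob_eq_0) auto
qed

lemma prob_max_walk_le:
  "\<P>(\<omega> in M. max_walk Z Y n \<omega> \<le> y) = (pgf p ^^ n) \<P>(\<omega> in M. walk Y 0 n \<omega> \<le> y)"
proof -
  note [measurable] = galton_watson_measurable[OF gw] max_walk_measurable
  have "\<P>(\<omega> in M. max_walk Z Y n \<omega> \<le> y) = \<P>(\<omega> in M. \<forall>j<Z n \<omega>. walk Y j n \<omega> \<in> {..y})"
  proof (rule measure_eq_AE)
    show "AE \<omega> in M. \<omega> \<in> {\<omega>\<in>space M. max_walk Z Y n \<omega> \<le> y} \<longleftrightarrow>
        \<omega> \<in> {\<omega>\<in>space M. \<forall>j<Z n \<omega>. walk Y j n \<omega> \<in> {..y}}"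
      using AE_population_pos[of n]
    proof eventually_elim
      case (elim \<omega>)
      then have "{..<Z n \<omega>} \<noteq> {}" by auto
      then show ?case by (auto simp: max_walk_def)
    qed
    have "Measurable.pred M (\<lambda>\<omega>. \<forall>j<Z n \<omega>. walk Y j n \<omega> \<in> {..y})"
      by (rule measurable_compose_countable[where f = "\<lambda>z \<omega>. \<forall>j<z. walk Y j n \<omega> \<in> {..y}"]) measurable
    then show "{\<omega>\<in>space M. \<forall>j<Z n \<omega>. walk Y j n \<omega> \<in> {..y}} \<in> events" by simp
  qed measurable
  then show ?thesis using prob_all_walks[of "{..y}" n] by simp
qed

lemma prob_max_walk_ge:
  "\<P>(\<omega> in M. y \<le> max_walk Z Y n \<omega>) = 1 - (pgf p ^^ n) (1 - \<P>(\<omega> in M. y \<le> walk Y 0 n \<omega>))"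
proof -
  note [measurable] = galton_watson_measurable[OF gw] max_walk_measurable
  have "\<P>(\<omega> in M. max_walk Z Y n \<omega> < y) = \<P>(\<omega> in M. \<forall>j<Z n \<omega>. walk Y j n \<omega> \<in> {..<y})"
  proof (rule measure_eq_AE)
    show "AE \<omega> in M. \<omega> \<in> {\<omega>\<in>space M. max_walk Z Y n \<omega> < y} \<longleftrightarrow>
        \<omega> \<in> {\<omega>\<in>space M. \<forall>j<Z n \<omega>. walk Y j n \<omega> \<in> {..<y}}"
      using AE_population_pos[of n]
    proof eventually_elim
      case (elim \<omega>)
      then have "{..<Z n \<omega>} \<noteq> {}" by auto
      then show ?case by (auto simp: max_walk_def)
    qed
    have "Measurable.pred M (\<lambda>\<omega>. \<forall>j<Z n \<omega>. walk Y j n \<omega> \<in> {..<y})"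
      by (rule measurable_compose_countable[where f = "\<lambda>z \<omega>. \<forall>j<z. walk Y j n \<omega> \<in> {..<y}"]) measurable
    then show "{\<omega>\<in>space M. \<forall>j<Z n \<omega>. walk Y j n \<omega> \<in> {..<y}} \<in> events" by simp
  qed measurable
  also have "\<dots> = (pgf p ^^ n) \<P>(\<omega> in M. walk Y 0 n \<omega> < y)"
    using prob_all_walks[of "{..<y}" n] by simp
  also have "\<P>(\<omega> in M. walk Y 0 n \<omega> < y) = 1 - \<P>(\<omega> in M. y \<le> walk Y 0 n \<omega>)"
    using prob_neg[of "\<lambda>\<omega>. y \<le> walk Y 0 n \<omega>"] by (simp add: not_le)
  finally show ?thesis
    using prob_neg[of "\<lambda>\<omega>. y \<le> max_walk Z Y n \<omega>"] by (simp add: not_le)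
qed

end
end
end
end

section \<open>The three regimes of the maximum\<close>

theorem theorem3p5:
  fixes M :: "'a measure" and N :: "'b measure"
    and X :: "'b \<Rightarrow> real" and Y :: "nat \<Rightarrow> nat \<Rightarrow> 'a \<Rightarrow> real"
    and Z :: "nat \<Rightarrow> 'a \<Rightarrow> nat" and p :: "nat pmf"
    and lp lm r m \<alpha> :: real and ap am :: "real \<Rightarrow> real"
  assumes "prob_space M" and "prob_space N"
    and "step_assumption N X lp lm r ap am"
    and "branching_assumption M p Z"
    and "pmf p 0 + pmf p 1 = 0"
    and "iid_copies M Y N X"
    and "indep_families M Z Y"
    and m: "m = offspring_mean p"
    and \<alpha>: "\<alpha> = (ln m / lp) powr (1 / r)"
  shows
    "(\<forall>x\<ge>\<alpha>. log_rate (\<lambda>n. \<P>(\<omega> in M. max_walk Z Y n \<omega> \<ge> x * real n powr (1 / r)))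
                (- (lp * x powr r - ln m)))
     \<and> (\<forall>x. 0 \<le> x \<and> x < \<alpha> \<longrightarrow>
          (\<lambda>n. ln \<bar>ln \<P>(\<omega> in M. max_walk Z Y n \<omega> \<le> x * real n powr (1 / r))\<bar>)
            \<sim>[sequentially]
          (\<lambda>n. real n * ln (real (kstar p)) * (1 - lp * x powr r / ln m)))
     \<and> (\<forall>x<0.
          (\<lambda>n. ln \<P>(\<omega> in M. max_walk Z Y n \<omega> \<le> x * real n powr (1 / r)))
            \<sim>[sequentially]
          (\<lambda>n. - real n * real (kstar p) ^ n * lm * \<bar>x\<bar> powr r))"
proof -
  interpret prob_space M by fact
  interpret N: prob_space N by fact
  interpret offspring p
    using assms by unfold_locales (auto simp: branching_assumption_def)
  have step: "integrable N X" "0 < lp" "0 < lm" "0 < r" "r < 1" "slowly_varying ap" "slowly_varying am"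
    and right: "\<And>x. 0 \<le> x \<Longrightarrow> \<P>(\<omega> in N. x \<le> X \<omega>) = ap x * exp (- lp * x powr r)"
    and left: "\<And>x. 0 \<le> x \<Longrightarrow> \<P>(\<omega> in N. X \<omega> \<le> - x) = am x * exp (- lm * x powr r)"
    using \<open>step_assumption N X lp lm r ap am\<close> by (auto simp: step_assumption_def)
  note iid = \<open>iid_copies M Y N X\<close>
  have gw: "galton_watson M p Z" using assms by (simp add: branching_assumption_def)
  note max_le = prob_max_walk_le[OF iid gw \<open>indep_families M Z Y\<close> pmf_0]
    and max_ge = prob_max_walk_ge[OF iid gw \<open>indep_families M Z Y\<close> pmf_0]
  note [measurable] = step_measurable[OF iid] walk_measurable[OF iid]
  have X [measurable]: "X \<in> borel_measurable N" using step(1) by auto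

  define D where "D = distr N borel X"
  \<comment> \<open>Reflection: the left tail of \<open>X\<close> is the right tail of
    \<open>- X\<close>, so one large deviation lemma serves both sides.\<close>
  define D' where "D' = distr N borel (\<lambda>\<omega>. - X \<omega>)"
  have D: "real_distribution D" "real_distribution D'"
    unfolding D_def D'_def
    by (auto intro!: real_distribution.intro N.prob_space_distr simp: real_distribution_axioms_def)
  have "measure D {x..} = ap x * exp (- lp * x powr r)" if "0 \<le> x" for x
  proof -
    have "measure D {x..} = N.prob (X -` {x..} \<inter> space N)"
      unfolding D_def by (rule measure_distr) auto
    also have "X -` {x..} \<inter> space N = {\<omega>\<in>space N. x \<le> X \<omega>}" by auto
    finally show ?thesis using right[OF that] by simp
  qed
  then have tail: "stretched_tail D lp r"
    using step by (intro stretched_tailI[OF D(1)])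
  have "measure D' {x..} = am x * exp (- lm * x powr r)" if "0 \<le> x" for x
  proof -
    have "measure D' {x..} = N.prob ((\<lambda>\<omega>. - X \<omega>) -` {x..} \<inter> space N)"
      unfolding D'_def by (rule measure_distr) auto
    also have "(\<lambda>\<omega>. - X \<omega>) -` {x..} \<inter> space N = {\<omega>\<in>space N. X \<omega> \<le> - x}" by auto
    finally show ?thesis using left[OF that] by simp
  qed
  then have tail': "stretched_tail D' lm r"
    using step by (intro stretched_tailI[OF D(2)])
  have int: "integrable D (\<lambda>u. u)" "integrable D' (\<lambda>u. u)"
    unfolding D_def D'_def using step(1) by (auto simp: integrable_distr_eq)
  have distr: "distr M borel (Y 0 i) = D" for i
    using iid by (simp add: iid_copies_def D_def)
  have distr': "distr M borel (\<lambda>\<omega>. - Y 0 i \<omega>) = D'" for i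
  proof -
    have "distr M borel (\<lambda>\<omega>. - Y 0 i \<omega>) = distr (distr M borel (Y 0 i)) borel uminus"
      by (subst distr_distr) (auto simp: comp_def)
    also have "\<dots> = D'"
      unfolding distr D_def D'_def by (subst distr_distr) (auto simp: comp_def)
    finally show ?thesis .
  qed
  have indep': "indep_vars (\<lambda>_. borel) (\<lambda>i \<omega>. - Y 0 i \<omega>) UNIV"
    by (rule indep_vars_compose2[OF indep_steps[OF iid]]) auto

  define y where "y x n = x * real n powr (1 / r)" for x n
  have rate: "log_rate (\<lambda>n. \<P>(\<omega> in M. y x n \<le> walk Y 0 n \<omega>)) (- (lp * x powr r))" if "0 < x" for x
    unfolding y_def walk_def
    using log_rate_iid_sum[OF indep_steps[OF iid] distr int(1) tail] step that by blast
  have rate': "log_rate (\<lambda>n. \<P>(\<omega> in M. walk Y 0 n \<omega> \<le> - y x n)) (- (lm * x powr r))" if "0 < x" for x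
  proof -
    have "log_rate (\<lambda>n. \<P>(\<omega> in M. x * real n powr (1 / r) \<le> (\<Sum>i<n. - Y 0 i \<omega>))) (- (lm * x powr r))"
      using log_rate_iid_sum[OF indep' distr' int(2) tail'] step that by blast
    then show ?thesis by (simp add: y_def walk_def sum_negf le_minus_iff)
  qed
  have mono: "y a n \<le> y b n" if "a \<le> b" for a b n
    unfolding y_def using that by (simp add: mult_right_mono)
  \<comment> \<open>The event in (ii) is the complement of a strict inequality, and
    \<open>x = 0\<close> is included, where \<open>rate\<close> says nothing. Comparison with the
    levels \<open>x + d\<close> from below, and with \<open>x\<close> or the trivial bound 1 from
    above, gives the same rate.\<close>
  have rate_strict: "log_rate (\<lambda>n. \<P>(\<omega> in M. y x n < walk Y 0 n \<omega>)) (- (lp * x powr r))"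
    if x: "0 \<le> x" for x
  proof (rule log_rateI)
    fix e :: real assume e: "0 < e"
    have "((\<lambda>d. lp * (x + d) powr r) \<longlongrightarrow> lp * (x + 0) powr r) (at_right 0)"
    proof (cases "x = 0")
      case True
      have "((\<lambda>d. lp * d powr r) \<longlongrightarrow> 0) (at_right 0)" using step by real_asymp
      then show ?thesis using True by simp
    next
      case False
      then show ?thesis by (intro tendsto_intros) auto
    qed
    then have "\<forall>\<^sub>F d in at_right 0. lp * (x + d) powr r < lp * x powr r + e / 2"
      by (rule order_tendstoD(2)) (use e in simp)
    then have "\<forall>\<^sub>F d in at_right 0. lp * (x + d) powr r < lp * x powr r + e / 2 \<and> 0 < d"
      by (intro eventually_conj eventually_at_right_less)
    then obtain d where d: "lp * (x + d) powr r < lp * x powr r + e / 2" "0 < d"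
      by (auto dest!: eventually_happens simp: trivial_limit_at_right_real)
    have "0 < x + d" "0 < e / 2" using x d e by auto
    from log_rateD(1)[OF rate[OF this(1)] this(2)] eventually_gt_at_top[of 0]
    show "\<forall>\<^sub>F n in sequentially. exp (real n * (- (lp * x powr r) - e)) \<le> \<P>(\<omega> in M. y x n < walk Y 0 n \<omega>)"
    proof eventually_elim
      case (elim n)
      have "exp (real n * (- (lp * x powr r) - e)) \<le> exp (real n * (- (lp * (x + d) powr r) - e / 2))"
        unfolding exp_le_cancel_iff using d by (intro mult_left_mono) auto
      also have "\<dots> \<le> \<P>(\<omega> in M. y (x + d) n \<le> walk Y 0 n \<omega>)" by fact
      also have "\<dots> \<le> \<P>(\<omega> in M. y x n < walk Y 0 n \<omega>)"
      proof (rule finite_measure_mono)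
        have "y x n < y (x + d) n" unfolding y_def using d elim by (intro mult_strict_right_mono) auto
        then show "{\<omega>\<in>space M. y (x + d) n \<le> walk Y 0 n \<omega>} \<subseteq> {\<omega>\<in>space M. y x n < walk Y 0 n \<omega>}" by auto
      qed measurable
      finally show ?case .
    qed
    show "\<forall>\<^sub>F n in sequentially. \<P>(\<omega> in M. y x n < walk Y 0 n \<omega>) \<le> exp (real n * (- (lp * x powr r) + e))"
    proof (cases "x = 0")
      case True
      have "\<P>(\<omega> in M. y x n < walk Y 0 n \<omega>) \<le> exp (real n * (- (lp * x powr r) + e))" for n
      proof -
        have "\<P>(\<omega> in M. y x n < walk Y 0 n \<omega>) \<le> 1" by (rule prob_le_1)
        also have "1 \<le> exp (real n * (- (lp * x powr r) + e))" using e True by simp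
        finally show ?thesis .
      qed
      then show ?thesis by simp
    next
      case False
      then have "0 < x" using x by simp
      from log_rateD(2)[OF rate[OF this] e] show ?thesis
      proof eventually_elim
        case (elim n)
        have "\<P>(\<omega> in M. y x n < walk Y 0 n \<omega>) \<le> \<P>(\<omega> in M. y x n \<le> walk Y 0 n \<omega>)"
          by (rule finite_measure_mono) auto
        with elim show ?case by linarith
      qed
    qed
  qed

  have \<alpha>_pos: "0 < \<alpha>" and \<alpha>_powr: "lp * \<alpha> powr r = ln m"
    using ln_mean_pos step by (auto simp: \<alpha> m powr_powr)

  have "log_rate (\<lambda>n. \<P>(\<omega> in M. y x n \<le> max_walk Z Y n \<omega>)) (- (lp * x powr r - ln m))" if x: "\<alpha> \<le> x" for x
  proof -
    have "lp * \<alpha> powr r \<le> lp * x powr r"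
      using x \<alpha>_pos step by (intro mult_left_mono powr_mono2) auto
    then have "log_rate (\<lambda>n. 1 - (pgf p ^^ n) (1 - \<P>(\<omega> in M. y x n \<le> walk Y 0 n \<omega>))) (ln m - lp * x powr r)"
      using x \<alpha>_pos unfolding m
      by (intro log_rate_survival rate) (auto simp: \<alpha>_powr[unfolded m])
    then show ?thesis by (simp add: max_ge)
  qed
  moreover have "(\<lambda>n. ln \<bar>ln \<P>(\<omega> in M. max_walk Z Y n \<omega> \<le> y x n)\<bar>) \<sim>[sequentially]
      (\<lambda>n. real n * ln (real (kstar p)) * (1 - lp * x powr r / ln m))" if x: "0 \<le> x" "x < \<alpha>" for x
  proof -
    have "x powr r < \<alpha> powr r" using x step by (intro powr_less_mono2) auto
    then have l: "0 \<le> lp * x powr r" "lp * x powr r < ln m"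
      using step by (auto simp: \<alpha>_powr[symmetric])
    have neg: "1 - \<P>(\<omega> in M. y x n < walk Y 0 n \<omega>) = \<P>(\<omega> in M. walk Y 0 n \<omega> \<le> y x n)" for n
      using prob_neg[of "\<lambda>\<omega>. y x n < walk Y 0 n \<omega>"] by (simp add: not_less)
    \<comment> \<open>As \<open>y x n \<ge> 0\<close>, it suffices that the walk is below
      \<open>- y 1 n\<close>; this has rate \<open>lm\<close>, and the added 1 is the error allowed
      in that rate.\<close>
    have "\<forall>\<^sub>F n in sequentially. exp (- (lm + 1) * real n) \<le> 1 - \<P>(\<omega> in M. y x n < walk Y 0 n \<omega>)"
      using log_rateD(1)[OF rate'[OF zero_less_one] zero_less_one]
    proof eventually_elim
      case (elim n)
      have "0 \<le> y x n" "0 \<le> y 1 n" using x by (auto simp: y_def)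
      then have "\<P>(\<omega> in M. walk Y 0 n \<omega> \<le> - y 1 n) \<le> \<P>(\<omega> in M. walk Y 0 n \<omega> \<le> y x n)"
        by (intro finite_measure_mono) auto
      moreover have "exp (- (lm + 1) * real n) = exp (real n * (- (lm * 1 powr r) - 1))"
        by (simp add: algebra_simps)
      ultimately show ?case using elim unfolding neg by linarith
    qed
    then show ?thesis
      using log_log_pgf_iterate_asymp[OF _ _ rate_strict[OF x(1)], of "lm + 1"] l
      by (simp add: neg max_le m)
  qed
  moreover have "(\<lambda>n. ln \<P>(\<omega> in M. max_walk Z Y n \<omega> \<le> y x n)) \<sim>[sequentially]
      (\<lambda>n. - real n * real (kstar p) ^ n * lm * \<bar>x\<bar> powr r)" if x: "x < 0" for x
  proof -
    have "log_rate (\<lambda>n. \<P>(\<omega> in M. walk Y 0 n \<omega> \<le> y x n)) (- (lm * \<bar>x\<bar> powr r))"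
      using rate'[of "\<bar>x\<bar>"] x by (simp add: y_def)
    then show ?thesis
      using log_pgf_iterate_asymp[of "\<lambda>n. \<P>(\<omega> in M. walk Y 0 n \<omega> \<le> y x n)" "lm * \<bar>x\<bar> powr r"] x step
      by (simp add: max_le mult.assoc)
  qed
  ultimately show ?thesis unfolding y_def by blast
qed

end
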